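(* Let $k_0\ge 1$ and suppose that, for each $n$, the network $\mathbf{A}_{n\times n}$ is generated from a stochastic block model with $k_0$ communities and parameters $\pi_0\in\Pi^{k_0}$ and $P_0=\rho_n S_0\in\mathcal P^{k_0}$, where $S_0$ is a fixed matrix not depending on $n$, $P_0$ has no two identical columns, and either $\rho_n\to 0$ and $n\rho_n\to\infty$ as $n\to\infty$, or $\rho_n=1$ for all $n$. Let $\epsilon>0$ and let $$\mathrm{pen}(k,n)=\sum_{i=1}^{k-1}\left(\frac{i(i+2)+1+\epsilon}{2}\right)\log n .$$ Then the estimator $$\hat k_{\mathrm{NML}}(\mathbf{A}_{n\times n})=\arg\max_{1\le k\le n}\left\{\log \mathrm{NML}_k(\mathbf{A}_{n\times n})-\mathrm{pen}(k,n)\right\}$$ satisfies $\hat k_{\mathrm{NML}}(\mathbf{A}_{n\times n})=k_0$ eventually almost surely as $n\to\infty$.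
   Context: **Networks.** A network on $n$ nodes is an undirected simple graph, identified with its symmetric adjacency matrix $\mathbf a_{n\times n}=(a_{ij})\in\{0,1\}^{n\times n}$ with zero diagonal; sums $\sum_{\mathbf x_{n\times n}}$ run over all networks on $n$ nodes. $[k]=\{1,\dots,k\}$. **Parameter spaces.** $\mathcal P^k=\{P\in[0,1]^{k\times k}: P\text{ symmetric}\}$, $\Pi^k=\{\pi\in(0,1]^k:\sum_{a=1}^k\pi_a=1\}$. **Stochastic block model (SBM)** with $k$ communities and parameters $\pi\in\Pi^k$, $P\in\mathcal P^k$: the labels $\mathbf Z_n=(Z_1,\dots,Z_n)$ are i.i.d. with $\mathbb P(Z_i=a)=\pi_a$, $a\in[k]$; conditionally on $\mathbf Z_n$ the variables $A_{ij}$, $1\le i<j\le n$, are independent and $A_{ij}$ given $Z_i=a,Z_j=b$ is Bernoulli$(P_{ab})$. **Likelihoods.** For $\mathbf z_n\in[k]^n$ let $n_a(\mathbf z_n)=\sum_{i=1}^n \mathbf 1\{z_i=a\}$; for $a\ne b$ let $o_{ab}(\mathbf a_{n\times n},\mathbf z_n)=\sum_{i,j=1}^n a_{ij}\mathbf 1\{z_i=a,z_j=b\}$ and $n_{ab}(\mathbf z_n)=n_a(\mathbf z_n)n_b(\mathbf z_n)$; let $o_{aa}(\mathbf a_{n\times n},\mathbf z_n)=\sum_{i<j}a_{ij}\mathbf 1\{z_i=a,z_j=a\}$ and $n_{aa}(\mathbf z_n)=\tfrac12 n_a(\mathbf z_n)(n_a(\mathbf z_n)-1)$. Put (with $0^0=1$)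 $$\mathbb P_P(\mathbf a_{n\times n}\mid\mathbf z_n)=\prod_{1\le a\le b\le k}P_{ab}^{o_{ab}}(1-P_{ab})^{n_{ab}-o_{ab}},\quad \mathbb P_\pi(\mathbf z_n)=\prod_{a=1}^k\pi_a^{n_a(\mathbf z_n)},$$ $$\mathbb P_{\pi,P}(\mathbf a_{n\times n})=\sum_{\mathbf e_n\in[k]^n}\mathbb P_P(\mathbf a_{n\times n}\mid\mathbf e_n)\,\mathbb P_\pi(\mathbf e_n).$$ **Normalized Maximum Likelihood.** $$\mathrm{NML}_k(\mathbf a_{n\times n})=\frac{\sup_{\pi\in\Pi^k,P\in\mathcal P^k}\mathbb P_{\pi,P}(\mathbf a_{n\times n})}{\sum_{\mathbf x_{n\times n}}\sup_{\pi\in\Pi^k,P\in\mathcal P^k}\mathbb P_{\pi,P}(\mathbf x_{n\times n})}.$$ **Conventions.** $\pi_0$ is fixed; $\rho_n>0$. The networks for different $n$ live on a common probability space. "Eventually almost surely as $n\to\infty$" means: with probability one there is a (random) $N$ such that the property holds for all $n\ge N$. *)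

theory Defs
  imports "HOL-Probability.Probability"
begin

text \<open>Nodes are \<open>{1..n}\<close> and communities are \<open>{1..k}\<close>.  A network is its adjacency matrix,
  extended by \<open>0\<close> outside \<open>{1..n}\<close>, so that \<open>networks n\<close> contains each network exactly once.\<close>

type_synonym network = "nat \<Rightarrow> nat \<Rightarrow> nat"

definition networks :: "nat \<Rightarrow> network set" where
  "networks n = {x. (\<forall>i j. x i j \<in> {0, 1}) \<and> (\<forall>i j. x i j = x j i) \<and> (\<forall>i. x i i = 0) \<and>
                    (\<forall>i j. i \<notin> {1..n} \<longrightarrow> x i j = 0)}"

text \<open>Only the entries with indices in \<open>{1..k}\<close> matter in the two parameter spaces; the other
  values are unconstrained and never used.\<close>

definition prob_matrices :: "nat \<Rightarrow> (nat \<Rightarrow> nat \<Rightarrow> real) set" where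
  "prob_matrices k = {P. \<forall>a\<in>{1..k}. \<forall>b\<in>{1..k}. 0 \<le> P a b \<and> P a b \<le> 1 \<and> P a b = P b a}"

definition label_weights :: "nat \<Rightarrow> (nat \<Rightarrow> real) set" where
  "label_weights k = {\<pi>. (\<forall>a\<in>{1..k}. 0 < \<pi> a \<and> \<pi> a \<le> 1) \<and> (\<Sum>a=1..k. \<pi> a) = 1}"

definition distinct_columns :: "nat \<Rightarrow> (nat \<Rightarrow> nat \<Rightarrow> real) \<Rightarrow> bool" where
  "distinct_columns k P \<longleftrightarrow>
     (\<forall>a\<in>{1..k}. \<forall>b\<in>{1..k}. a \<noteq> b \<longrightarrow> (\<exists>c\<in>{1..k}. P c a \<noteq> P c b))"

subsection \<open>The stochastic block model\<close>

definition label_pmf :: "nat \<Rightarrow> (nat \<Rightarrow> real) \<Rightarrow> nat pmf" where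
  "label_pmf k \<pi> = embed_pmf (\<lambda>a. if a \<in> {1..k} then \<pi> a else 0)"

lemma pmf_label_pmf:
  assumes "\<pi> \<in> label_weights k"
  shows "pmf (label_pmf k \<pi>) a = (if a \<in> {1..k} then \<pi> a else 0)"
proof -
  let ?f = "\<lambda>a. if a \<in> {1..k} then \<pi> a else 0"
  have nn: "0 \<le> ?f a" for a
    using assms by (auto simp: label_weights_def intro: less_imp_le)
  have "(\<integral>\<^sup>+ a. ennreal (?f a) \<partial>count_space UNIV) = (\<Sum>a\<in>{1..k}. ennreal (?f a))"
    by (rule nn_integral_count_space'[of "{1..k}"]) auto
  also have "\<dots> = ennreal (\<Sum>a\<in>{1..k}. ?f a)"
    by (rule sum_ennreal) (rule nn)
  also have "\<dots> = 1"
    using assms by (simp add: label_weights_def)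
  finally show ?thesis
    unfolding label_pmf_def by (rule pmf_embed_pmf[OF nn])
qed

definition node_pairs :: "nat \<Rightarrow> (nat \<times> nat) set" where
  "node_pairs n = {(i, j). 1 \<le> i \<and> i < j \<and> j \<le> n}"

text \<open>\<open>Pi_pmf\<close> gives the default value \<open>False\<close> to every pair outside \<open>node_pairs n\<close>; hence the
  matrix below vanishes on the diagonal and outside \<open>{1..n}\<close>.\<close>

definition network_of_edges :: "(nat \<times> nat \<Rightarrow> bool) \<Rightarrow> network" where
  "network_of_edges e i j = of_bool (e (min i j, max i j))"

text \<open>Joint law of the labels and the network.\<close>

definition sbm :: "nat \<Rightarrow> (nat \<Rightarrow> real) \<Rightarrow> (nat \<Rightarrow> nat \<Rightarrow> real) \<Rightarrow> nat \<Rightarrow>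
    ((nat \<Rightarrow> nat) \<times> network) pmf" where
  "sbm k \<pi> P n =
     bind_pmf (Pi_pmf {1..n} undefined (\<lambda>_. label_pmf k \<pi>)) (\<lambda>z.
     bind_pmf (Pi_pmf (node_pairs n) False (\<lambda>(i, j). bernoulli_pmf (P (z i) (z j)))) (\<lambda>e.
     return_pmf (z, network_of_edges e)))"

definition sbm_network :: "nat \<Rightarrow> (nat \<Rightarrow> real) \<Rightarrow> (nat \<Rightarrow> nat \<Rightarrow> real) \<Rightarrow> nat \<Rightarrow> network pmf" where
  "sbm_network k \<pi> P n = map_pmf snd (sbm k \<pi> P n)"

subsection \<open>Likelihoods\<close>

definition node_count :: "nat \<Rightarrow> (nat \<Rightarrow> nat) \<Rightarrow> nat \<Rightarrow> nat" where
  "node_count n z a = (\<Sum>i=1..n. of_bool (z i = a))"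

text \<open>The product \<open>m * (m - 1)\<close> is even, so \<open>div\<close> is exact.\<close>

definition pair_count :: "nat \<Rightarrow> (nat \<Rightarrow> nat) \<Rightarrow> nat \<Rightarrow> nat \<Rightarrow> nat" where
  "pair_count n z a b =
     (if a = b then node_count n z a * (node_count n z a - 1) div 2
      else node_count n z a * node_count n z b)"

definition edge_count :: "nat \<Rightarrow> network \<Rightarrow> (nat \<Rightarrow> nat) \<Rightarrow> nat \<Rightarrow> nat \<Rightarrow> nat" where
  "edge_count n x z a b =
     (if a = b then \<Sum>(i, j)\<in>node_pairs n. x i j * of_bool (z i = a \<and> z j = a)
      else \<Sum>i=1..n. \<Sum>j=1..n. x i j * of_bool (z i = a \<and> z j = b))"

text \<open>For \<open>x \<in> networks n\<close> one has \<open>edge_count n x z a b \<le> pair_count n z a b\<close>, so the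
  subtraction in the exponent does not truncate.\<close>

definition cond_likelihood ::
    "nat \<Rightarrow> nat \<Rightarrow> (nat \<Rightarrow> nat \<Rightarrow> real) \<Rightarrow> network \<Rightarrow> (nat \<Rightarrow> nat) \<Rightarrow> real" where
  "cond_likelihood k n P x z =
     (\<Prod>(a, b)\<in>{(a, b). 1 \<le> a \<and> a \<le> b \<and> b \<le> k}.
        P a b ^ edge_count n x z a b * (1 - P a b) ^ (pair_count n z a b - edge_count n x z a b))"

definition label_likelihood :: "nat \<Rightarrow> nat \<Rightarrow> (nat \<Rightarrow> real) \<Rightarrow> (nat \<Rightarrow> nat) \<Rightarrow> real" where
  "label_likelihood k n \<pi> z = (\<Prod>a=1..k. \<pi> a ^ node_count n z a)"

definition likelihood ::
    "nat \<Rightarrow> nat \<Rightarrow> (nat \<Rightarrow> real) \<Rightarrow> (nat \<Rightarrow> nat \<Rightarrow> real) \<Rightarrow> network \<Rightarrow> real" where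
  "likelihood k n \<pi> P x =
     (\<Sum>z\<in>{1..n} \<rightarrow>\<^sub>E {1..k}. cond_likelihood k n P x z * label_likelihood k n \<pi> z)"

definition max_likelihood :: "nat \<Rightarrow> nat \<Rightarrow> network \<Rightarrow> real" where
  "max_likelihood k n x =
     (SUP (\<pi>, P)\<in>label_weights k \<times> prob_matrices k. likelihood k n \<pi> P x)"

definition NML :: "nat \<Rightarrow> nat \<Rightarrow> network \<Rightarrow> real" where
  "NML k n x = max_likelihood k n x / (\<Sum>y\<in>networks n. max_likelihood k n y)"

definition pen :: "real \<Rightarrow> nat \<Rightarrow> nat \<Rightarrow> real" where
  "pen \<epsilon> k n = (\<Sum>i=1..k-1. (real i * (real i + 2) + 1 + \<epsilon>) / 2 * ln (real n))"

text \<open>The maximizer over \<open>{1..n}\<close> need not be unique; \<open>k\<close> is any one of them.\<close>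

definition is_nml_estimate :: "real \<Rightarrow> nat \<Rightarrow> network \<Rightarrow> nat \<Rightarrow> bool" where
  "is_nml_estimate \<epsilon> n x k \<longleftrightarrow>
     is_arg_max (\<lambda>k. ln (NML k n x) - pen \<epsilon> k n) (\<lambda>k. 1 \<le> k \<and> k \<le> n) k"

end

theory Submission
  imports Defs
begin

text \<open>Overestimation is a change of measure: the law of the network is dominated by the maximum
  likelihood of the true model, that is by the Shtarkov sum of that model times its \<open>NML\<close>.  So a
  larger model wins with probability at most the Shtarkov sum times the exponential of the penalty
  difference.  Comparing the maximized likelihood with Krichevsky--Trofimov mixtures bounds the
  Shtarkov sum by \<open>n\<close> to the power \<open>(k (k + 2) - 1) / 2\<close>: a factor \<open>n\<close> for each entry of \<open>P\<close>, which
  is fitted to up to \<open>n\<^sup>2\<close> pairs, and \<open>sqrt n\<close> for each free label weight.  This leaves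
  \<open>n\<close> to the power \<open>- 1 - \<epsilon> / 2\<close>.

  Underestimation: for fixed labels of the smaller model only polynomially many matrices \<open>P\<close> matter,
  so there are at most \<open>exp (O n)\<close> candidates.  Under typical true labels each of them has
  Bhattacharyya coefficient at most \<open>exp (- c n\<^sup>2 \<rho> n)\<close> with the true law, which wins because
  \<open>n \<rho> n\<close> is unbounded.  Both bounds are summable, and the Borel--Cantelli lemma applies.\<close>

section \<open>Krichevsky--Trofimov weights\<close>

text \<open>The likelihood is a sum over hidden labelings and has no explicit maximizer, so no
  estimate is ever computed. For overestimation the mixture bound is applied to each labeling
  separately, with constants independent of the parameters, and therefore passes through both the
  sum and the supremum. The number of competing orders grows with \<open>n\<close>; an order beyond
  the next one pays at least one further summand of the penalty, worth a factor
  \<open>1 / n\<close>, so all orders together cost a constant. For underestimation the best matrix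
  of the smaller model depends on the network. Replacing it by a sum over a finite set of candidates
  makes each competitor a fixed product law. The true labels are hidden too: fixing one labeling
  costs the inverse of its probability, again only exponential in \<open>n\<close>. In the sparse
  regime all edge probabilities vanish. Distances are therefore measured between square roots: the
  squared difference of \<open>sqrt (\<rho> * s)\<close> and \<open>sqrt (\<rho> * t)\<close> is
  exactly linear in \<open>\<rho>\<close>, so one gap for the fixed matrix serves all
  \<open>n\<close>.\<close>

lemma Suc_half_ln_ge:
  fixes n :: nat
  assumes "n \<ge> 1"
  shows "1 \<le> (real n + 1/2) * ln (1 + 1 / real n)"
proof -
  \<comment> \<open>Midpoint bound for the integral of the convex function \<open>1 / x\<close> over
    an interval of length one.\<close>
  have "ln (real n + 1) - ln (real n) \<ge> 2 * ((real n + 1) - real n) / (real n + (real n + 1))"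
    using assms by (intro ln_inverse_approx_ge) auto
  moreover have "ln (1 + 1 / real n) = ln (real n + 1) - ln (real n)"
    using assms by (subst ln_divide_pos[symmetric]) (auto simp: field_simps)
  moreover have "2 * ((real n + 1) - real n) / (real n + (real n + 1)) = 1 / (real n + 1/2)"
    by (simp add: field_simps)
  ultimately have "1 / (real n + 1/2) \<le> ln (1 + 1 / real n)"
    by simp
  then show ?thesis
    by (subst (asm) pos_divide_le_eq) (auto simp: mult.commute add_pos_pos)
qed

text \<open>Stirling's upper bound. On the logarithmic scale the induction step is exactly
  \<open>Suc_half_ln_ge\<close>: the quotient of the left side by \<open>sqrt n * n^n\<close> does
  not increase, and it equals \<open>exp 1\<close> at \<open>n = 1\<close>.\<close>

lemma fact_mult_exp_le:
  fixes n :: nat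
  assumes "n \<ge> 1"
  shows "fact n * exp (real n) \<le> exp 1 * sqrt (real n) * real n ^ n"
  using assms
proof (induction n rule: dec_induct)
  case base
  show ?case by simp
next
  case (step n)
  have n: "real n > 0" using step by simp
  define L where "L = ln (1 + 1 / real n)"
  have L: "ln (real n + 1) = ln (real n) + L"
  proof -
    have "1 + 1 / real n > 0" using n by (intro add_pos_pos) auto
    then have "ln (real n * (1 + 1 / real n)) = ln (real n) + L"
      unfolding L_def using n by (intro ln_mult_pos) auto
    also have "real n * (1 + 1 / real n) = real n + 1" using n by (simp add: field_simps)
    finally show ?thesis .
  qed
  have fe: "ln (fact n * exp (real n)) = ln (fact n) + real n"
    by (simp add: ln_mult)
  have "ln (fact n) + real n \<le> 1 + ln (real n) / 2 + real n * ln (real n)"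
  proof -
    have "ln (fact n * exp (real n)) \<le> ln (exp 1 * sqrt (real n) * real n ^ n)"
      using step.IH n by (subst ln_le_cancel_iff) auto
    then show ?thesis using n by (simp add: ln_mult ln_realpow ln_sqrt)
  qed
  moreover have "1 \<le> (real n + 1/2) * L"
    unfolding L_def using step by (intro Suc_half_ln_ge) auto
  ultimately have "ln (real n + 1) + ln (fact n) + real n + 1
      \<le> 1 + ln (real n + 1) / 2 + (real n + 1) * ln (real n + 1)"
    unfolding L by (simp add: algebra_simps add_divide_distrib)
  then have "ln (fact (Suc n) * exp (real (Suc n)))
      \<le> ln (exp 1 * sqrt (real (Suc n)) * real (Suc n) ^ Suc n)"
  proof -
    have "ln (fact (Suc n) * exp (real (Suc n))) = ln (real n + 1) + ln (fact n) + real n + 1"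
      by (simp add: ln_mult)
    moreover have "ln (exp 1 * sqrt (real (Suc n)) * real (Suc n) ^ Suc n)
        = 1 + ln (real n + 1) / 2 + (real n + 1) * ln (real n + 1)"
      using n by (simp add: ln_mult ln_realpow ln_sqrt add.commute del: power_Suc)
    ultimately show ?thesis using \<open>ln (real n + 1) + _ + _ + _ \<le> _\<close> by linarith
  qed
  then show ?case by (subst (asm) ln_le_cancel_iff) auto
qed

text \<open>The quotient of the right side by the left starts at 1 for \<open>m = 0\<close> and
  never decreases. From \<open>m = Suc j\<close> to \<open>Suc m\<close> it is multiplied by
  \<open>exp 1 / r j\<close>, and \<open>r\<close> increases to the limit \<open>exp 1\<close>. The
  step from 0 to 1 is separate: its factor is \<open>exp 1 / 2\<close>.\<close>

lemma pochhammer_half_ge: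
  "real m ^ m \<le> exp (real m) * pochhammer (1/2) m"
proof -
  define r where "r = (\<lambda>m. (1 + 1 / real (Suc m)) ^ Suc m * ((real m + 2) / (real m + 3/2)))"
  have r_pos: "r m > 0" for m 
  proof -
    have "1 + 1 / real (Suc m) > 0" by (intro add_pos_pos) auto
    then show ?thesis unfolding r_def by (intro mult_pos_pos zero_less_power) auto
  qed
  have "r \<longlonglongrightarrow> exp 1 * 1"
    unfolding r_def
  proof (intro tendsto_mult)
    show "(\<lambda>m. (1 + 1 / real (Suc m)) ^ Suc m) \<longlonglongrightarrow> exp 1"
      using LIMSEQ_Suc[OF tendsto_exp_limit_sequentially[of 1]] by simp
    have "(\<lambda>m. 1 + (1/2) * inverse (real m + 3/2)) \<longlonglongrightarrow> 1 + (1/2) * 0"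
      by (intro tendsto_intros tendsto_inverse_0_at_top filterlim_tendsto_add_at_top[OF tendsto_const]
          filterlim_at_top_mono[OF filterlim_real_sequentially]) auto
    also have "(\<lambda>m. 1 + (1/2) * inverse (real m + 3/2)) = (\<lambda>m. (real m + 2) / (real m + 3/2))"
      by (auto simp: field_simps)
    finally show "(\<lambda>m. (real m + 2) / (real m + 3/2)) \<longlonglongrightarrow> 1" by simp
  qed
  moreover have "incseq r"
  proof (rule incseq_SucI)
    fix m
    define x where "x = real (Suc m)"
    have x: "x > 0" "real m = x - 1" by (auto simp: x_def)
    \<comment> \<open>\<open>ln r\<close> at a real argument. In its derivative the terms with
      \<open>1 / (t + 1)\<close> cancel, and what remains,
      \<open>ln (t + 1) - ln t - 1 / (t + 1/2)\<close>, is nonnegative by the midpoint bound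
      again.\<close>
    define \<phi> where "\<phi> = (\<lambda>x::real. x * (ln (x + 1) - ln x) + (ln (x + 1) - ln (x + 1/2)))"
    have ln_r: "ln (r j) = \<phi> (real (Suc j))" for j
    proof -
      have "ln (r j) = real (Suc j) * ln (1 + 1 / real (Suc j)) + ln ((real j + 2) / (real j + 3/2))"
        unfolding r_def using r_pos[of j, unfolded r_def] by (subst ln_mult) (auto simp: ln_realpow simp del: power_Suc)
      also have "ln (1 + 1 / real (Suc j)) = ln (real (Suc j) + 1) - ln (real (Suc j))"
        by (subst ln_divide_pos[symmetric]) (auto simp: field_simps)
      also have "ln ((real j + 2) / (real j + 3/2)) = ln (real (Suc j) + 1) - ln (real (Suc j) + 1/2)"
        by (subst ln_divide_pos) (auto simp: add.commute)
      finally show ?thesis by (simp add: \<phi>_def)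
    qed
    have "\<phi> x \<le> \<phi> (x + 1)"
    proof (rule DERIV_nonneg_imp_nondecreasing[of x "x + 1" \<phi>])
      fix t assume t: "x \<le> t" "t \<le> x + 1"
      have t0: "t > 0" using t x by linarith
      have "(\<phi> has_real_derivative (ln (t + 1) - ln t) + t * (1 / (t+1) - 1 / t)
              + (1 / (t+1) - 1 / (t + 1/2))) (at t)"
        unfolding \<phi>_def using t0 by (auto intro!: derivative_eq_intros)
      moreover have "ln (t + 1) - ln t \<ge> 2 * ((t + 1) - t) / (t + (t + 1))"
        using t0 by (intro ln_inverse_approx_ge) auto
      then have "(ln (t + 1) - ln t) + t * (1 / (t+1) - 1 / t) + (1 / (t+1) - 1 / (t + 1/2)) \<ge> 0"
      proof -
        have "t * (1 / (t+1) - 1 / t) = - (1 / (t + 1))" using t0 by (simp add: divide_simps)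
        moreover have "2 * ((t + 1) - t) / (t + (t + 1)) = 1 / (t + 1/2)"
          using t0 by (simp add: field_simps)
        ultimately show ?thesis
          using \<open>ln (t + 1) - ln t \<ge> 2 * ((t + 1) - t) / (t + (t + 1))\<close> by linarith
      qed
      ultimately show "\<exists>y. (\<phi> has_real_derivative y) (at t) \<and> 0 \<le> y" by blast
    qed auto
    then have "ln (r m) \<le> ln (r (Suc m))"
      unfolding ln_r by (simp add: x_def algebra_simps)
    then show "r m \<le> r (Suc m)" using r_pos by (subst (asm) ln_le_cancel_iff) auto
  qed
  ultimately have r_le: "r m \<le> exp 1" for m
    using incseq_le[of r] by simp
  show ?thesis
  proof (induction m)
    case 0
    show ?case by simp
  next
    case (Suc m)
    show ?case
    proof (cases "m = 0")
      case True
      have "(2::real) \<le> exp 1" using exp_ge_add_one_self[of 1] by simp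
      then show ?thesis using True by (simp add: pochhammer_Suc)
    next
      case False
      then obtain j where j: "m = Suc j" by (cases m) auto
      have m: "real m > 0" using False by simp
      have "real (Suc m) ^ Suc m = real m ^ m * ((1 + 1 / real m) ^ m * (real m + 1))"
      proof -
        have "real m ^ m * (1 + 1 / real m) ^ m = (real m + 1) ^ m"
          using m by (subst power_mult_distrib[symmetric]) (simp add: distrib_left add.commute)
        then show ?thesis by (simp add: algebra_simps)
      qed
      also have "(1 + 1 / real m) ^ m * (real m + 1) = r j * (real m + 1/2)"
      proof -
        have "(real j + 2) / (real j + 3/2) * (real (Suc j) + 1/2) = real (Suc j) + 1"
          by (simp add: field_simps)
        then show ?thesis unfolding r_def j by (simp only: mult.assoc)
      qed
      also have "real m ^ m * (r j * (real m + 1/2)) \<le>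
          (exp (real m) * pochhammer (1/2) m) * (exp 1 * (real m + 1/2))"
        using Suc r_le[of j] less_imp_le[OF r_pos[of j]]
        by (intro mult_mono mult_nonneg_nonneg) (auto simp: pochhammer_nonneg)
      also have "\<dots> = exp (real (Suc m)) * pochhammer (1/2) (Suc m)"
        by (simp add: pochhammer_Suc exp_add algebra_simps)
      finally show ?thesis .
    qed
  qed
qed

text \<open>The convergent series for the reciprocal Gamma function bounds
  \<open>pochhammer s (Suc m)\<close> by a multiple of \<open>fact m * m powr s\<close>, and
  Stirling's bound replaces the factorial. The base \<open>Suc n\<close> of the power keeps the
  bound meaningful at \<open>n = 0\<close>, where \<open>0 powr x = 0\<close>.\<close>

lemma pochhammer_le_powr:
  fixes s :: real
  assumes "s > 0"
  obtains C where "C > 0" "\<And>n. exp (real n) * pochhammer s n \<le> C * real (Suc n) powr (s - 1/2) * real n ^ n"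
proof -
  have "Bseq (rGamma_series s)"
    by (rule convergent_imp_Bseq, rule convergentI, rule rGamma_series_LIMSEQ)
  then obtain B where B: "B > 0" "\<And>n. norm (rGamma_series s n) \<le> B"
    by (auto simp: Bseq_def)
  have po: "pochhammer s (Suc n) \<le> B * fact n * real n powr s" if "n \<ge> 1" for n
  proof -
    have "rGamma_series s n \<le> B" using B(2)[of n] by (simp add: abs_le_iff)
    then show ?thesis using that
      by (simp add: rGamma_series_def powr_def field_simps)
  qed
  \<comment> \<open>One factor \<open>exp 1\<close> comes from \<open>exp (Suc m)\<close>, the other
    from Stirling's bound; the power of 4 compares \<open>m\<close> with \<open>m + 2\<close> for an
    exponent \<open>s - 1/2\<close> of either sign. The maximum in \<open>C\<close> below covers
    \<open>n = 0\<close> and \<open>n = 1\<close>, which the series does not reach.\<close>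
  define D where "D = B * exp 1 * exp 1 * 4 powr \<bar>s - 1/2\<bar>"
  have D: "D > 0" using B by (simp add: D_def)
  define C where "C = max 1 (max D (exp 1 * s * 2 powr (1/2 - s)))"
  have *: "exp (real n) * pochhammer s n \<le> C * real (Suc n) powr (s - 1/2) * real n ^ n" for n
  proof -
    consider "n = 0" | "n = 1" | m where "n = Suc m" "m \<ge> 1"
      by (metis One_nat_def Suc_leI gr0I not0_implies_Suc)
    then show ?thesis
    proof cases
      case 1
      then show ?thesis by (simp add: C_def)
    next
      case 2
      have "exp 1 * s = (exp 1 * s * 2 powr (1/2 - s)) * 2 powr (s - 1/2)"
        by (simp add: powr_add[symmetric])
      also have "\<dots> \<le> C * 2 powr (s - 1/2)"
        by (intro mult_right_mono) (auto simp: C_def)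
      finally show ?thesis using 2 by simp
    next
      case 3
      have m: "real m > 0" using 3 by simp
      have "exp (real n) * pochhammer s n \<le> exp 1 * exp (real m) * (B * fact m * real m powr s)"
        unfolding 3 using po[OF 3(2)] by (auto simp: exp_add)
      also have "\<dots> = exp 1 * B * real m powr s * (fact m * exp (real m))" by simp
      also have "\<dots> \<le> exp 1 * B * real m powr s * (exp 1 * sqrt (real m) * real m ^ m)"
        using B 3 by (intro mult_left_mono fact_mult_exp_le) auto
      also have "\<dots> = exp 1 * exp 1 * B * (real m powr (s - 1/2)) * real m ^ Suc m"
      proof -
        have "real m * real m powr (s - 1/2) = real m powr (1 + (s - 1/2))"
          using m by (subst powr_add) auto
        also have "\<dots> = real m powr (s + 1/2)" by (simp add: add.commute)
        also have "\<dots> = real m powr s * sqrt (real m)"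
          using m by (subst powr_add) (auto simp: powr_half_sqrt)
        finally show ?thesis by (simp add: mult_ac)
      qed
      also have "\<dots> \<le> exp 1 * exp 1 * B * (4 powr \<bar>s - 1/2\<bar> * real (Suc n) powr (s - 1/2)) * real n ^ n"
      proof -
        have "real m powr (s - 1/2) \<le> 4 powr \<bar>s - 1/2\<bar> * real (Suc n) powr (s - 1/2)"
        proof (cases "s - 1/2 \<ge> 0")
          case True
          have "1 * real m powr (s - 1/2) \<le> 4 powr \<bar>s - 1/2\<bar> * real (Suc n) powr (s - 1/2)"
            using True 3 m by (intro mult_mono ge_one_powr_ge_zero powr_mono2) auto
          then show ?thesis by simp
        next
          case False
          have "real (Suc n) powr (1/2 - s) \<le> (4 * real m) powr (1/2 - s)"
            using False 3 by (intro powr_mono2) auto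
          also have "\<dots> = 4 powr (1/2 - s) * real m powr (1/2 - s)"
            using m by (simp add: powr_mult)
          finally have "real (Suc n) powr - (s - 1/2) \<le> 4 powr (1/2 - s) * real m powr - (s - 1/2)"
            by simp
          then have "real m powr (s - 1/2) \<le> 4 powr (1/2 - s) * real (Suc n) powr (s - 1/2)"
            using m unfolding powr_minus[of _ "s - 1/2"] by (simp add: field_simps del: of_nat_Suc)
          moreover have "\<bar>s - 1/2\<bar> = 1/2 - s" using False by simp
          ultimately show ?thesis by (simp only:)
        qed
        moreover have "real m ^ Suc m \<le> real n ^ n"
          unfolding 3 by (intro power_mono) auto
        ultimately show ?thesis using B by (intro mult_mono[OF mult_left_mono]) auto
      qed
      also have "\<dots> = D * (real (Suc n) powr (s - 1/2) * real n ^ n)"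
        by (simp add: D_def)
      also have "\<dots> \<le> C * (real (Suc n) powr (s - 1/2) * real n ^ n)"
        by (intro mult_right_mono) (auto simp: C_def)
      finally show ?thesis by simp
    qed
  qed
  show ?thesis
    by (rule that[OF _ *]) (auto simp: C_def)
qed

section \<open>Multinomial likelihoods against mixture weights\<close>

lemma weight_power_le:
  fixes p N :: real and m :: nat
  assumes "p \<ge> 0" "N \<ge> real m"
  shows "p ^ m \<le> (real m / N) ^ m * exp (p * N - real m)"
proof (cases "m = 0")
  case True
  then show ?thesis using assms by simp
next
  case False
  have N: "N > 0" using assms False by linarith
  \<comment> \<open>This is \<open>x \<le> exp (x - 1)\<close>, raised to the power \<open>m\<close>
    below. When the bounds for all categories are multiplied, the weights \<open>p\<close> sum to 1
    and the counts \<open>m\<close> to \<open>N\<close>, so the exponentials cancel: Gibbs'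
    inequality, one factor at a time.\<close>
  have "p * N / real m \<le> exp (p * N / real m - 1)"
    using exp_ge_add_one_self[of "p * N / real m - 1"] by simp
  then have "(p * N / real m) ^ m \<le> exp (p * N / real m - 1) ^ m"
    using assms N by (intro power_mono) auto
  also have "exp (p * N / real m - 1) ^ m = exp (p * N - real m)"
    using False by (simp add: exp_of_nat_mult[symmetric] algebra_simps)
  finally have "(real m / N) ^ m * (p * N / real m) ^ m \<le> (real m / N) ^ m * exp (p * N - real m)"
    using N by (intro mult_left_mono) auto
  also have "(real m / N) ^ m * (p * N / real m) ^ m = p ^ m"
    using N False by (simp add: power_mult_distrib[symmetric])
  finally show ?thesis .
qed

text \<open>The integral of the product of the \<open>p a ^ m a\<close> over the Dirichlet
  distribution with all parameters \<open>1/2\<close>, in closed form. It is the mixture probability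
  of one particular sequence with counts \<open>m\<close>.\<close>

definition kt_weight :: "'k set \<Rightarrow> ('k \<Rightarrow> nat) \<Rightarrow> real" where
  "kt_weight K m = (\<Prod>a\<in>K. pochhammer (1/2) (m a)) / pochhammer (real (card K) / 2) (\<Sum>a\<in>K. m a)"

lemma kt_weight_nonneg: "kt_weight K m \<ge> 0"
proof -
  have "pochhammer (real (card K) / 2) (\<Sum>a\<in>K. m a) \<ge> 0"
    by (cases "card K = 0") (auto simp: pochhammer_0_left intro!: pochhammer_nonneg)
  then show ?thesis
    by (auto simp: kt_weight_def intro!: divide_nonneg_nonneg prod_nonneg pochhammer_nonneg)
qed

text \<open>\<open>weight_power_le\<close> and \<open>pochhammer_half_ge\<close> bound the product
  by \<open>exp N / N^N\<close> times the numerator of the weight. Inserting the denominator leaves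
  the growth of \<open>pochhammer (card K / 2) N\<close>, hence the exponent
  \<open>(card K - 1) / 2\<close>. The constant depends on \<open>K\<close> only.\<close>

lemma prod_power_le_kt_weight:
  assumes "finite K" "K \<noteq> {}"
  obtains C where "C > 0"
    "\<And>(p :: 'k \<Rightarrow> real) m. (\<And>a. a \<in> K \<Longrightarrow> p a \<ge> 0) \<Longrightarrow> (\<Sum>a\<in>K. p a) = 1 \<Longrightarrow>
       (\<Prod>a\<in>K. p a ^ m a) \<le> C * real (Suc (\<Sum>a\<in>K. m a)) powr ((real (card K) - 1) / 2) * kt_weight K m"
proof -
  have s: "real (card K) / 2 > 0" using assms by (simp add: card_gt_0_iff)
  obtain C where C: "C > 0" "\<And>n. exp (real n) * pochhammer (real (card K) / 2) n
      \<le> C * real (Suc n) powr (real (card K) / 2 - 1/2) * real n ^ n"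
    by (rule pochhammer_le_powr[OF s]) blast
  show ?thesis
  proof (rule that[OF C(1)])
    fix p :: "'k \<Rightarrow> real" and m :: "'k \<Rightarrow> nat"
    assume p: "\<And>a. a \<in> K \<Longrightarrow> p a \<ge> 0" "(\<Sum>a\<in>K. p a) = 1"
    define N where "N = (\<Sum>a\<in>K. m a)"
    define H where "H = (\<Prod>a\<in>K. pochhammer (1/2::real) (m a))"
    have H: "H \<ge> 0" unfolding H_def by (intro prod_nonneg ballI pochhammer_nonneg) auto
    have mN: "m a \<le> N" if "a \<in> K" for a
      unfolding N_def using assms that by (intro member_le_sum) auto
    have NN: "real N ^ N > 0" by (cases "N = 0") auto
    have po: "pochhammer (real (card K) / 2) N > 0" using s by (intro pochhammer_pos)
    have "(\<Prod>a\<in>K. p a ^ m a) \<le> (\<Prod>a\<in>K. exp (p a * real N) * pochhammer (1/2) (m a) / real N ^ m a)"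
    proof (intro prod_mono conjI)
      fix a assume a: "a \<in> K"
      show "0 \<le> p a ^ m a" using p a by simp
      have "p a ^ m a \<le> (real (m a) / real N) ^ m a * exp (p a * real N - real (m a))"
        using p a mN by (intro weight_power_le) auto
      also have "\<dots> = real (m a) ^ m a * (exp (p a * real N - real (m a)) / real N ^ m a)"
        by (simp add: power_divide)
      also have "\<dots> \<le> exp (real (m a)) * pochhammer (1/2) (m a) * (exp (p a * real N - real (m a)) / real N ^ m a)"
        by (intro mult_right_mono pochhammer_half_ge) auto
      also have "\<dots> = exp (p a * real N) * pochhammer (1/2) (m a) / real N ^ m a"
        by (simp add: exp_diff)
      finally show "p a ^ m a \<le> exp (p a * real N) * pochhammer (1/2) (m a) / real N ^ m a" .
    qed
    also have "\<dots> = exp (real N) * H / real N ^ N"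
    proof -
      have "(\<Prod>a\<in>K. exp (p a * real N)) = exp (real N)"
        using p(2) assms(1) by (simp add: exp_sum[symmetric] sum_distrib_right[symmetric])
      moreover have "(\<Prod>a\<in>K. real N ^ m a) = real N ^ N"
        by (simp add: N_def power_sum)
      ultimately show ?thesis by (simp add: prod_dividef prod.distrib H_def)
    qed
    also have "\<dots> = exp (real N) * pochhammer (real (card K) / 2) N / real N ^ N * kt_weight K m"
      using po by (simp add: kt_weight_def H_def N_def)
    also have "\<dots> \<le> C * real (Suc N) powr ((real (card K) - 1) / 2) * kt_weight K m"
    proof (intro mult_right_mono kt_weight_nonneg)
      have "(real (card K) - 1) / 2 = real (card K) / 2 - 1/2" by simp
      then show "exp (real N) * pochhammer (real (card K) / 2) N / real N ^ N
          \<le> C * real (Suc N) powr ((real (card K) - 1) / 2)"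
        using C(2)[of N] NN by (simp only: pos_divide_le_eq)
    qed
    finally show "(\<Prod>a\<in>K. p a ^ m a) \<le> C * real (Suc (\<Sum>a\<in>K. m a)) powr ((real (card K) - 1) / 2) * kt_weight K m"
      unfolding N_def .
  qed
qed

text \<open>The add-one-half rule: the factor is the predictive probability of the symbol
  \<open>b\<close> after counts \<open>m\<close>.\<close>

lemma kt_weight_Suc:
  assumes "finite K" "b \<in> K"
  shows "kt_weight K (m(b := Suc (m b))) =
         kt_weight K m * ((1/2 + real (m b)) / (real (card K) / 2 + real (\<Sum>a\<in>K. m a)))"
proof -
  have "(\<Sum>a\<in>K. (m(b := Suc (m b))) a) = Suc (\<Sum>a\<in>K. m a)"
    using assms by (simp add: sum.remove[of K b])
  moreover have "(\<Prod>a\<in>K. pochhammer (1/2::real) ((m(b := Suc (m b))) a)) =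
      (\<Prod>a\<in>K. pochhammer (1/2) (m a)) * (1/2 + real (m b))"
    using assms by (simp add: prod.remove[of K b] pochhammer_Suc)
  ultimately show ?thesis
    by (simp add: kt_weight_def pochhammer_Suc)
qed

text \<open>Each colour \<open>d\<close> runs its own sequential predictor on the positions of that
  colour. Adding a position multiplies the weight by a predictive probability in its colour class,
  and these sum to 1 over the symbols. Used with the blocks as colours of the node pairs, and with a
  single colour for the labels.\<close>

lemma sum_prod_kt_weight:
  fixes I :: "'i set" and K :: "'k set" and D :: "'d set" and c :: "'i \<Rightarrow> 'd"
  assumes "finite I" "finite K" "K \<noteq> {}" "finite D" "c ` I \<subseteq> D"
  shows "(\<Sum>f\<in>I \<rightarrow>\<^sub>E K. \<Prod>d\<in>D. kt_weight K (\<lambda>a. card {i\<in>I. c i = d \<and> f i = a})) = 1"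
  using assms(1,5)
proof (induction I rule: finite_induct)
  case empty
  show ?case by (simp add: kt_weight_def)
next
  case (insert i I)
  define w where "w = (\<lambda>f. \<Prod>d\<in>D. kt_weight K (\<lambda>a. card {i\<in>I. c i = d \<and> f i = a}))"
  define m where "m = (\<lambda>(f :: 'i \<Rightarrow> 'k) a. card {j\<in>I. c j = c i \<and> f j = a})"
  have step: "(\<Prod>d\<in>D. kt_weight K (\<lambda>a. card {j\<in>insert i I. c j = d \<and> (f(i := b)) j = a}))
      = w f * ((1/2 + real (m f b)) / (real (card K) / 2 + real (\<Sum>a\<in>K. m f a)))"
    if b: "b \<in> K" for f b
  proof -
    have ci: "c i \<in> D" using insert.prems by simp
    have 1: "{j\<in>insert i I. c j = d \<and> (f(i := b)) j = a} =
        (if d = c i \<and> a = b then insert i {j\<in>I. c j = d \<and> f j = a} else {j\<in>I. c j = d \<and> f j = a})" for d a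
      using insert.hyps by auto
    have 2: "(\<lambda>a. card {j\<in>insert i I. c j = d \<and> (f(i := b)) j = a}) =
        (if d = c i then (m f)(b := Suc (m f b)) else (\<lambda>a. card {j\<in>I. c j = d \<and> f j = a}))" for d
      unfolding 1 using insert.hyps by (auto simp: m_def fun_eq_iff)
    have "(\<Prod>d\<in>D. kt_weight K (\<lambda>a. card {j\<in>insert i I. c j = d \<and> (f(i := b)) j = a}))
       = kt_weight K ((m f)(b := Suc (m f b))) *
         (\<Prod>d\<in>D - {c i}. kt_weight K (\<lambda>a. card {j\<in>I. c j = d \<and> f j = a}))"
      unfolding 2 using assms(4) ci by (subst prod.remove[of D "c i"]) (auto intro!: prod.cong)
    also have "kt_weight K ((m f)(b := Suc (m f b))) = kt_weight K (m f) *
       ((1/2 + real (m f b)) / (real (card K) / 2 + real (\<Sum>a\<in>K. m f a)))"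
      by (rule kt_weight_Suc[OF assms(2) b])
    also have "\<dots> * (\<Prod>d\<in>D - {c i}. kt_weight K (\<lambda>a. card {j\<in>I. c j = d \<and> f j = a})) =
       w f * ((1/2 + real (m f b)) / (real (card K) / 2 + real (\<Sum>a\<in>K. m f a)))"
      unfolding w_def m_def using prod.remove[OF assms(4) ci, of "\<lambda>d. kt_weight K (\<lambda>a. card {j\<in>I. c j = d \<and> f j = a})"]
      by simp
    finally show ?thesis .
  qed
  have "(\<Sum>f\<in>insert i I \<rightarrow>\<^sub>E K. \<Prod>d\<in>D. kt_weight K (\<lambda>a. card {j\<in>insert i I. c j = d \<and> f j = a}))
      = (\<Sum>(b, f)\<in>K \<times> (I \<rightarrow>\<^sub>E K). \<Prod>d\<in>D. kt_weight K (\<lambda>a. card {j\<in>insert i I. c j = d \<and> (f(i := b)) j = a}))"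
    using insert.hyps
    by (subst PiE_insert_eq, subst sum.reindex)
       (auto intro: inj_combinator[of _ _ "\<lambda>_. K", unfolded case_prod_unfold] simp: case_prod_unfold)
  also have "\<dots> = (\<Sum>(b, f)\<in>K \<times> (I \<rightarrow>\<^sub>E K).
      w f * ((1/2 + real (m f b)) / (real (card K) / 2 + real (\<Sum>a\<in>K. m f a))))"
    unfolding case_prod_unfold by (intro sum.cong refl step) auto
  also have "\<dots> = (\<Sum>b\<in>K. \<Sum>f\<in>I \<rightarrow>\<^sub>E K.
      w f * ((1/2 + real (m f b)) / (real (card K) / 2 + real (\<Sum>a\<in>K. m f a))))"
    by (simp add: sum.cartesian_product)
  also have "\<dots> = (\<Sum>f\<in>I \<rightarrow>\<^sub>E K. \<Sum>b\<in>K.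
      w f * ((1/2 + real (m f b)) / (real (card K) / 2 + real (\<Sum>a\<in>K. m f a))))"
    by (rule sum.swap)
  also have "\<dots> = (\<Sum>f\<in>I \<rightarrow>\<^sub>E K. w f)"
  proof (rule sum.cong[OF refl])
    fix f
    have "real (card K) / 2 + real (\<Sum>a\<in>K. m f a) > 0"
      using assms(2,3) by (intro add_pos_nonneg of_nat_0_le_iff) (simp_all add: card_gt_0_iff sum_nonneg)
    moreover have "(\<Sum>b\<in>K. 1/2 + real (m f b)) = real (card K) / 2 + real (\<Sum>a\<in>K. m f a)"
      by (simp add: sum.distrib)
    ultimately show "(\<Sum>b\<in>K. w f * ((1/2 + real (m f b)) / (real (card K) / 2 + real (\<Sum>a\<in>K. m f a)))) = w f"
      by (simp add: sum_distrib_left[symmetric] sum_divide_distrib[symmetric])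
  qed
  also have "\<dots> = 1" unfolding w_def using insert by simp
  finally show ?case .
qed

section \<open>Likelihoods as products over node pairs\<close>

definition class_pairs :: "nat \<Rightarrow> (nat \<times> nat) set" where
  "class_pairs k = {(a, b). 1 \<le> a \<and> a \<le> b \<and> b \<le> k}"

text \<open>Ordered by \<open>min\<close> and \<open>max\<close> to match the indices
  \<open>a \<le> b\<close> of the likelihood; by symmetry of \<open>P\<close> this ordered form
  determines the edge probability.\<close>

definition pair_class :: "(nat \<Rightarrow> nat) \<Rightarrow> nat \<times> nat \<Rightarrow> nat \<times> nat" where
  "pair_class z = (\<lambda>(i, j). (min (z i) (z j), max (z i) (z j)))"

definition edge :: "network \<Rightarrow> nat \<times> nat \<Rightarrow> nat" where
  "edge x = (\<lambda>(i, j). x i j)"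

lemma edge_cases: "x \<in> networks n \<Longrightarrow> edge x p = 0 \<or> edge x p = 1"
  by (auto simp: networks_def edge_def split: prod.splits)

lemma finite_class_pairs [simp]: "finite (class_pairs k)"
  by (rule finite_subset[of _ "{1..k} \<times> {1..k}"]) (auto simp: class_pairs_def)

lemma finite_node_pairs [simp]: "finite (node_pairs n)"
  by (rule finite_subset[of _ "{1..n} \<times> {1..n}"]) (auto simp: node_pairs_def)

lemma finite_labelings [simp]: "finite ({a..n} \<rightarrow>\<^sub>E {b..k})" for a b n k :: nat
  by (intro finite_PiE) auto

lemma pair_class_in_class_pairs:
  "z \<in> {1..n} \<rightarrow>\<^sub>E {1..k} \<Longrightarrow> p \<in> node_pairs n \<Longrightarrow> pair_class z p \<in> class_pairs k"
  by (auto simp: pair_class_def node_pairs_def class_pairs_def PiE_iff min_def max_def)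

lemma sum_square_node_pairs:
  "(\<Sum>i=1..n. \<Sum>j=1..n. f i j) = (\<Sum>i=1..n. f i i) + (\<Sum>(i, j)\<in>node_pairs n. f i j + f j i)"
  for f :: "nat \<Rightarrow> nat \<Rightarrow> 'a :: comm_monoid_add"
proof -
  have 1: "{1..n} \<times> {1..n} = (\<lambda>i. (i, i)) ` {1..n} \<union> (node_pairs n \<union> prod.swap ` node_pairs n)"
    by (auto simp: node_pairs_def image_iff)
  have "(\<Sum>i=1..n. \<Sum>j=1..n. f i j) = (\<Sum>(i, j)\<in>{1..n} \<times> {1..n}. f i j)"
    by (simp add: sum.cartesian_product)
  also have "\<dots> = (\<Sum>(i, j)\<in>(\<lambda>i. (i, i)) ` {1..n}. f i j) +
      ((\<Sum>(i, j)\<in>node_pairs n. f i j) + (\<Sum>(i, j)\<in>prod.swap ` node_pairs n. f i j))"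
    unfolding 1 by (subst sum.union_disjoint, simp, simp, force simp: node_pairs_def,
      subst sum.union_disjoint) (simp, simp, force simp: node_pairs_def, rule refl)
  also have "(\<Sum>(i, j)\<in>(\<lambda>i. (i, i)) ` {1..n}. f i j) = (\<Sum>i=1..n. f i i)"
    by (subst sum.reindex) (auto simp: inj_on_def)
  also have "(\<Sum>(i, j)\<in>prod.swap ` node_pairs n. f i j) = (\<Sum>(i, j)\<in>node_pairs n. f j i)"
    by (subst sum.reindex) (auto simp: case_prod_unfold)
  finally show ?thesis by (simp add: sum.distrib case_prod_unfold)
qed

text \<open>As \<open>a\<close> and \<open>b\<close> differ, the diagonal contributes nothing and
  each unordered pair is counted in at most one of its two orders, so no factor 2 appears.\<close>

lemma sum_square_labels:
  fixes w :: "nat \<Rightarrow> nat \<Rightarrow> nat"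
  assumes "a < b" "\<And>i j. w i j = w j i"
  shows "(\<Sum>i=1..n. \<Sum>j=1..n. w i j * of_bool (z i = a \<and> z j = b)) =
         (\<Sum>(i, j)\<in>node_pairs n. w i j * of_bool (pair_class z (i, j) = (a, b)))"
proof -
  have "(\<Sum>i=1..n. w i i * of_bool (z i = a \<and> z i = b)) = 0"
    using assms(1) by (intro sum.neutral) auto
  then show ?thesis
    unfolding sum_square_node_pairs
    by (simp only: add_0, intro sum.cong refl)
       (use assms in \<open>auto simp: pair_class_def min_def max_def\<close>)
qed

lemma edge_count_eq_sum:
  assumes "x \<in> networks n" "a \<le> b"
  shows "edge_count n x z a b = (\<Sum>p\<in>node_pairs n. edge x p * of_bool (pair_class z p = (a, b)))"
proof -
  have sym: "x i j = x j i" for i j using assms by (auto simp: networks_def)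
  show ?thesis
  proof (cases "a = b")
    case True
    then show ?thesis
      by (auto simp: edge_count_def edge_def pair_class_def min_def max_def case_prod_unfold intro!: sum.cong)
  next
    case False
    then show ?thesis
      using assms(2) sum_square_labels[where w = x and a = a and b = b and n = n and z = z, OF _ sym] False
      by (simp add: edge_count_def edge_def case_prod_unfold del: sum_mult_of_bool_eq)
  qed
qed

lemma edge_count_eq_card:
  assumes "x \<in> networks n" "a \<le> b"
  shows "edge_count n x z a b = card {p \<in> node_pairs n. pair_class z p = (a, b) \<and> edge x p = 1}"
proof -
  have "edge x p * of_bool (pair_class z p = (a, b)) =
      (if p \<in> {p. pair_class z p = (a, b) \<and> edge x p = 1} then 1 else 0)" for p
    using edge_cases[OF assms(1), of p] by auto
  then show ?thesis
    unfolding edge_count_eq_sum[OF assms] by (simp add: sum.If_cases Int_def)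
qed

lemma pair_count_eq_card:
  assumes "a \<le> b"
  shows "pair_count n z a b = card {p \<in> node_pairs n. pair_class z p = (a, b)}"
proof -
  have card_eq: "card {p \<in> node_pairs n. pair_class z p = (a, b)} =
      (\<Sum>p\<in>node_pairs n. of_bool (pair_class z p = (a, b)))"
    by (simp add: Int_def)
  have nn: "node_count n z a * node_count n z b =
      (\<Sum>i=1..n. \<Sum>j=1..n. 1 * of_bool (z i = a \<and> z j = b))"
    unfolding node_count_def sum_product by (intro sum.cong) auto
  show ?thesis
  proof (cases "a = b")
    case True
    let ?m = "node_count n z a"
    \<comment> \<open>Ordered pairs within one community are the diagonal plus every unordered pair
      twice; this makes the halving in \<open>pair_count\<close> exact.\<close>
    have "?m * ?m = ?m + 2 * (\<Sum>p\<in>node_pairs n. of_bool (pair_class z p = (a, b)))"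
    proof -
      have "?m * ?m = (\<Sum>i=1..n. of_bool (z i = a)) +
          (\<Sum>p\<in>node_pairs n. 2 * of_bool (pair_class z p = (a, b)))"
        unfolding nn[unfolded True] True sum_square_node_pairs
        by (intro arg_cong2[where f = "(+)"] sum.cong refl)
          (auto simp: pair_class_def min_def max_def case_prod_unfold)
      then show ?thesis
        by (simp only: node_count_def sum_distrib_left)
    qed
    then have "?m * (?m - 1) = 2 * (\<Sum>p\<in>node_pairs n. of_bool (pair_class z p = (a, b)))"
      by (simp add: diff_mult_distrib2)
    then show ?thesis unfolding card_eq using True by (simp add: pair_count_def)
  next
    case False
    then have "node_count n z a * node_count n z b =
        (\<Sum>p\<in>node_pairs n. of_bool (pair_class z p = (a, b)))"
      unfolding nn using assms by (subst sum_square_labels) auto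
    then show ?thesis unfolding card_eq using False by (simp add: pair_count_def)
  qed
qed

lemma pair_count_diff_edge_count:
  assumes "x \<in> networks n" "a \<le> b"
  shows "pair_count n z a b - edge_count n x z a b =
         card {p \<in> node_pairs n. pair_class z p = (a, b) \<and> edge x p = 0}"
proof -
  have "{p \<in> node_pairs n. pair_class z p = (a, b) \<and> edge x p = 0} =
      {p \<in> node_pairs n. pair_class z p = (a, b)} -
      {p \<in> node_pairs n. pair_class z p = (a, b) \<and> edge x p = 1}"
    using edge_cases[OF assms(1)] by auto
  then show ?thesis
    unfolding pair_count_eq_card[OF assms(2)] edge_count_eq_card[OF assms]
    by (simp, subst card_Diff_subset) auto
qed

lemma edge_count_le_pair_count:
  assumes "x \<in> networks n" "a \<le> b"
  shows "edge_count n x z a b \<le> pair_count n z a b"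
  unfolding pair_count_eq_card[OF assms(2)] edge_count_eq_card[OF assms]
  by (intro card_mono) auto

lemma pair_count_le:
  assumes "a \<le> b"
  shows "pair_count n z a b \<le> n * n"
proof -
  have "pair_count n z a b \<le> card (node_pairs n)"
    unfolding pair_count_eq_card[OF assms] by (intro card_mono) auto
  also have "\<dots> \<le> card ({1..n} \<times> {1..n})"
    by (intro card_mono) (auto simp: node_pairs_def)
  finally show ?thesis by simp
qed

section \<open>The conditional likelihood as a product of Bernoulli factors\<close>

definition bern_weight :: "real \<Rightarrow> nat \<Rightarrow> real" where
  "bern_weight p y = (if y = 0 then 1 - p else p)"

lemma cond_likelihood_altdef:
  "cond_likelihood k n P x z =
     (\<Prod>(a, b)\<in>class_pairs k.
        P a b ^ edge_count n x z a b * (1 - P a b) ^ (pair_count n z a b - edge_count n x z a b))"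
  unfolding cond_likelihood_def class_pairs_def ..

text \<open>Node pairs are grouped by block. The form with one factor per pair is the one in which
  sums over all networks factorize.\<close>

lemma cond_likelihood_eq_prod:
  assumes x: "x \<in> networks n" and z: "z \<in> {1..n} \<rightarrow>\<^sub>E {1..k}" and P: "P \<in> prob_matrices k"
  shows "cond_likelihood k n P x z = (\<Prod>p\<in>node_pairs n. bern_weight (P (z (fst p)) (z (snd p))) (edge x p))"
proof -
  have "(\<Prod>p\<in>node_pairs n. bern_weight (P (z (fst p)) (z (snd p))) (edge x p)) =
      (\<Prod>c\<in>class_pairs k. \<Prod>p\<in>{p \<in> node_pairs n. pair_class z p = c}.
         bern_weight (P (z (fst p)) (z (snd p))) (edge x p))"
    using pair_class_in_class_pairs[OF z] by (intro prod.group[symmetric]) auto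
  also have "\<dots> = (\<Prod>(a, b)\<in>class_pairs k.
      P a b ^ edge_count n x z a b * (1 - P a b) ^ (pair_count n z a b - edge_count n x z a b))"
  proof (intro prod.cong refl, clarify)
    fix a b assume ab: "(a, b) \<in> class_pairs k"
    then have le: "a \<le> b" by (simp add: class_pairs_def)
    let ?S = "{p \<in> node_pairs n. pair_class z p = (a, b)}"
    have "(\<Prod>p\<in>?S. bern_weight (P (z (fst p)) (z (snd p))) (edge x p)) =
        (\<Prod>p\<in>?S. if edge x p = 1 then P a b else 1 - P a b)"
    proof (rule prod.cong[OF refl])
      fix p assume p: "p \<in> ?S"
      have "P (z (fst p)) (z (snd p)) = P a b"
        using p ab P by (cases p) (auto simp: pair_class_def min_def max_def prob_matrices_def class_pairs_def
            split: if_splits)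
      moreover have "edge x p \<in> {0, 1}"
        using edge_cases[OF x, of p] by auto
      ultimately show "bern_weight (P (z (fst p)) (z (snd p))) (edge x p) =
          (if edge x p = 1 then P a b else 1 - P a b)"
        by (auto simp: bern_weight_def)
    qed
    also have "\<dots> = P a b ^ card (?S \<inter> {p. edge x p = 1}) * (1 - P a b) ^ card (?S \<inter> - {p. edge x p = 1})"
      by (subst prod.If_cases) auto
    also have "?S \<inter> {p. edge x p = 1} = {p \<in> node_pairs n. pair_class z p = (a, b) \<and> edge x p = 1}"
      by auto
    also have "?S \<inter> - {p. edge x p = 1} = {p \<in> node_pairs n. pair_class z p = (a, b) \<and> edge x p = 0}"
      using edge_cases[OF x] by auto
    finally show "(\<Prod>p\<in>?S. bern_weight (P (z (fst p)) (z (snd p))) (edge x p)) =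
        P a b ^ edge_count n x z a b * (1 - P a b) ^ (pair_count n z a b - edge_count n x z a b)"
      using edge_count_eq_card[OF x le] pair_count_diff_edge_count[OF x le] by simp
  qed
  finally show ?thesis unfolding cond_likelihood_altdef ..
qed

section \<open>Sums over all networks\<close>

definition network_of :: "nat \<Rightarrow> (nat \<times> nat \<Rightarrow> nat) \<Rightarrow> network" where
  "network_of n g i j = (if (min i j, max i j) \<in> node_pairs n then g (min i j, max i j) else 0)"

lemma edge_network_of: "p \<in> node_pairs n \<Longrightarrow> edge (network_of n g) p = g p"
  by (auto simp: edge_def network_of_def node_pairs_def min_def max_def)

text \<open>A network is a free choice of an indicator for each node pair. This transfers statements
  about \<open>PiE\<close>, such as the exchange of sum and product and the normalization of the
  mixtures, to \<open>networks n\<close>.\<close>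

lemma bij_betw_network_of:
  "bij_betw (network_of n) (node_pairs n \<rightarrow>\<^sub>E {0, 1}) (networks n)"
proof (rule bij_betwI[where g = "\<lambda>x. restrict (edge x) (node_pairs n)"])
  show "network_of n \<in> (node_pairs n \<rightarrow>\<^sub>E {0, 1}) \<rightarrow> networks n"
  proof
    fix g assume g: "g \<in> node_pairs n \<rightarrow>\<^sub>E {0, 1 :: nat}"
    have "network_of n g i j \<in> {0, 1}" for i j
      using PiE_mem[OF g] by (auto simp: network_of_def)
    moreover have "network_of n g i j = network_of n g j i" for i j
      by (simp add: network_of_def min.commute max.commute)
    moreover have "network_of n g i i = 0" for i
      by (simp add: network_of_def node_pairs_def)
    moreover have "network_of n g i j = 0" if "i \<notin> {1..n}" for i j
      using that by (auto simp: network_of_def node_pairs_def min_def max_def)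
    ultimately show "network_of n g \<in> networks n"
      unfolding networks_def by blast
  qed
  show "(\<lambda>x. restrict (edge x) (node_pairs n)) \<in> networks n \<rightarrow> (node_pairs n \<rightarrow>\<^sub>E {0, 1})"
    by (auto simp: networks_def edge_def PiE_iff split: prod.splits)
  show "restrict (edge (network_of n g)) (node_pairs n) = g" if "g \<in> node_pairs n \<rightarrow>\<^sub>E {0, 1}" for g
    using that by (auto simp: edge_network_of PiE_iff extensional_def restrict_def fun_eq_iff)
  show "network_of n (restrict (edge x) (node_pairs n)) = x" if x: "x \<in> networks n" for x
  proof (intro ext)
    fix i j
    have sym: "x i j = x j i" and diag: "x i i = 0"
      and out: "i \<notin> {1..n} \<Longrightarrow> x i j = 0" "j \<notin> {1..n} \<Longrightarrow> x j i = 0"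
      using x by (auto simp: networks_def)
    show "network_of n (restrict (edge x) (node_pairs n)) i j = x i j"
      using sym diag out
      by (cases i j rule: linorder_cases) (auto simp: network_of_def edge_def node_pairs_def min_def max_def)
  qed
qed

lemma finite_networks [simp]: "finite (networks n)"
  using bij_betw_finite[OF bij_betw_network_of[of n]] by (simp add: finite_PiE)

lemma sum_networks_prod:
  fixes f :: "nat \<times> nat \<Rightarrow> nat \<Rightarrow> real"
  shows "(\<Sum>x\<in>networks n. \<Prod>p\<in>node_pairs n. f p (edge x p)) = (\<Prod>p\<in>node_pairs n. f p 0 + f p 1)"
proof -
  have "(\<Sum>x\<in>networks n. \<Prod>p\<in>node_pairs n. f p (edge x p)) =
      (\<Sum>g\<in>node_pairs n \<rightarrow>\<^sub>E {0, 1}. \<Prod>p\<in>node_pairs n. f p (edge (network_of n g) p))"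
    by (rule sum.reindex_bij_betw[OF bij_betw_network_of, symmetric])
  also have "\<dots> = (\<Sum>g\<in>node_pairs n \<rightarrow>\<^sub>E {0, 1}. \<Prod>p\<in>node_pairs n. f p (g p))"
    by (intro sum.cong prod.cong refl) (simp add: edge_network_of)
  also have "\<dots> = (\<Prod>p\<in>node_pairs n. f p 0 + f p 1)"
    by (subst prod_sum_PiE[symmetric]) auto
  finally show ?thesis .
qed

lemma sum_cond_likelihood:
  assumes "z \<in> {1..n} \<rightarrow>\<^sub>E {1..k}" "P \<in> prob_matrices k"
  shows "(\<Sum>x\<in>networks n. cond_likelihood k n P x z) = 1"
proof -
  have "(\<Sum>x\<in>networks n. cond_likelihood k n P x z) =
      (\<Sum>x\<in>networks n. \<Prod>p\<in>node_pairs n. bern_weight (P (z (fst p)) (z (snd p))) (edge x p))"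
    by (intro sum.cong refl cond_likelihood_eq_prod assms)
  also have "\<dots> = 1"
    by (subst sum_networks_prod) (simp add: bern_weight_def)
  finally show ?thesis .
qed

lemma cond_likelihood_nonneg:
  assumes "P \<in> prob_matrices k"
  shows "cond_likelihood k n P x z \<ge> 0"
  unfolding cond_likelihood_altdef
  using assms by (intro prod_nonneg) (auto simp: class_pairs_def prob_matrices_def)

lemma node_count_eq_card: "node_count n z a = card {i\<in>{1..n}. z i = a}"
  by (simp add: node_count_def Int_def)

lemma label_likelihood_eq_prod:
  assumes "z \<in> {1..n} \<rightarrow>\<^sub>E {1..k}"
  shows "label_likelihood k n \<pi> z = (\<Prod>i=1..n. \<pi> (z i))"
proof -
  have "(\<Prod>i=1..n. \<pi> (z i)) = (\<Prod>a\<in>{1..k}. \<Prod>i\<in>{i\<in>{1..n}. z i = a}. \<pi> (z i))"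
    using assms by (intro prod.group[symmetric]) auto
  also have "\<dots> = (\<Prod>a\<in>{1..k}. \<pi> a ^ node_count n z a)"
    by (intro prod.cong) (auto simp: node_count_eq_card)
  finally show ?thesis by (simp add: label_likelihood_def)
qed

lemma label_likelihood_nonneg: "\<pi> \<in> label_weights k \<Longrightarrow> label_likelihood k n \<pi> z \<ge> 0"
  unfolding label_likelihood_def by (intro prod_nonneg) (auto simp: label_weights_def intro: less_imp_le)

lemma sum_prod_labels:
  fixes f :: "nat \<Rightarrow> real" and n k :: nat
  shows "(\<Sum>z\<in>{1..n} \<rightarrow>\<^sub>E {1..k}. \<Prod>i=1..n. f (z i)) = (\<Sum>a=1..k. f a) ^ n"
  by (subst prod_sum_PiE[symmetric]) auto

lemma sum_label_likelihood:
  assumes "\<pi> \<in> label_weights k"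
  shows "(\<Sum>z\<in>{1..n} \<rightarrow>\<^sub>E {1..k}. label_likelihood k n \<pi> z) = 1"
  using assms sum_prod_labels[where f = \<pi> and n = n and k = k]
  by (simp add: label_likelihood_eq_prod label_weights_def cong: sum.cong)

lemma sum_likelihood:
  assumes "\<pi> \<in> label_weights k" "P \<in> prob_matrices k"
  shows "(\<Sum>x\<in>networks n. likelihood k n \<pi> P x) = 1"
proof -
  have "(\<Sum>x\<in>networks n. likelihood k n \<pi> P x) =
     (\<Sum>z\<in>{1..n} \<rightarrow>\<^sub>E {1..k}. \<Sum>x\<in>networks n. cond_likelihood k n P x z * label_likelihood k n \<pi> z)"
    unfolding likelihood_def by (rule sum.swap)
  also have "\<dots> = (\<Sum>z\<in>{1..n} \<rightarrow>\<^sub>E {1..k}. label_likelihood k n \<pi> z)"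
    by (intro sum.cong refl) (simp add: sum_distrib_right[symmetric] sum_cond_likelihood assms)
  also have "\<dots> = 1" by (rule sum_label_likelihood[OF assms(1)])
  finally show ?thesis .
qed

section \<open>The law of the model is given by the likelihood\<close>

lemma pmf_network_of_edges:
  assumes x: "x \<in> networks n" and z: "z \<in> {1..n} \<rightarrow>\<^sub>E {1..k}" and P: "P \<in> prob_matrices k"
  shows "pmf (map_pmf network_of_edges
      (Pi_pmf (node_pairs n) False (\<lambda>(i, j). bernoulli_pmf (P (z i) (z j))))) x = cond_likelihood k n P x z"
proof -
  define E where "E = Pi_pmf (node_pairs n) False (\<lambda>(i, j). bernoulli_pmf (P (z i) (z j)))"
  define e where "e = (\<lambda>p. p \<in> node_pairs n \<and> edge x p = 1)"
  have e_edge: "network_of_edges f = x \<longleftrightarrow> f = e" if "\<And>p. p \<notin> node_pairs n \<Longrightarrow> f p = False" for f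
  proof
    assume f: "network_of_edges f = x"
    show "f = e"
    proof
      fix p
      show "f p = e p"
      proof (cases "p \<in> node_pairs n")
        case True
        then obtain i j where ij: "p = (i, j)" "i < j" by (auto simp: node_pairs_def)
        have "x i j = of_bool (f p)"
          using ij unfolding f[symmetric] by (simp add: network_of_edges_def)
        then show ?thesis using True ij by (simp add: e_def edge_def)
      next
        case False
        then show ?thesis using that by (simp add: e_def)
      qed
    qed
  next
    assume f: "f = e"
    show "network_of_edges f = x"
    proof (intro ext)
      fix i j
      have sym: "x i j = x j i" and diag: "x i i = 0" and "x i j \<in> {0, 1}"
        and out: "i \<notin> {1..n} \<Longrightarrow> x i j = 0" "j \<notin> {1..n} \<Longrightarrow> x j i = 0"
        using x by (auto simp: networks_def)
      then show "network_of_edges f i j = x i j"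
        unfolding f by (cases i j rule: linorder_cases)
          (auto simp: network_of_edges_def e_def edge_def node_pairs_def min_def max_def)
    qed
  qed
  have "pmf (map_pmf network_of_edges E) x = measure E (network_of_edges -` {x} \<inter> set_pmf E)"
    by (simp add: pmf_map measure_Int_set_pmf)
  \<comment> \<open>\<open>network_of_edges\<close> ignores indicators at pairs in decreasing order,
    so a network has many preimages. Only one lies in the support, where everything outside
    \<open>node_pairs n\<close> has the default value \<open>False\<close>.\<close>
  also have "network_of_edges -` {x} \<inter> set_pmf E = {e} \<inter> set_pmf E"
  proof -
    have "f p = False" if "f \<in> set_pmf E" "p \<notin> node_pairs n" for f p
      using set_Pi_pmf_subset[OF finite_node_pairs, of n False "\<lambda>(i, j). bernoulli_pmf (P (z i) (z j))"] that unfolding E_def by blast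
    then show ?thesis using e_edge by blast
  qed
  also have "measure E ({e} \<inter> set_pmf E) = pmf E e"
    by (simp add: measure_Int_set_pmf pmf.rep_eq)
  also have "\<dots> = (\<Prod>p\<in>node_pairs n. pmf (bernoulli_pmf (P (z (fst p)) (z (snd p)))) (e p))"
    unfolding E_def by (subst pmf_Pi') (auto simp: e_def case_prod_unfold)
  also have "\<dots> = (\<Prod>p\<in>node_pairs n. bern_weight (P (z (fst p)) (z (snd p))) (edge x p))"
  proof (rule prod.cong[OF refl])
    fix p assume p: "p \<in> node_pairs n"
    then have "z (fst p) \<in> {1..k}" "z (snd p) \<in> {1..k}"
      using z by (auto simp: node_pairs_def PiE_iff)
    then have "0 \<le> P (z (fst p)) (z (snd p))" "P (z (fst p)) (z (snd p)) \<le> 1"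
      using P by (auto simp: prob_matrices_def)
    moreover have "edge x p \<in> {0, 1}"
      using edge_cases[OF x, of p] by auto
    ultimately show "pmf (bernoulli_pmf (P (z (fst p)) (z (snd p)))) (e p) =
        bern_weight (P (z (fst p)) (z (snd p))) (edge x p)"
      using p by (auto simp: e_def bern_weight_def)
  qed
  also have "\<dots> = cond_likelihood k n P x z"
    by (rule cond_likelihood_eq_prod[OF x z P, symmetric])
  finally show ?thesis unfolding E_def .
qed

lemma pmf_sbm_network:
  assumes x: "x \<in> networks n" and \<pi>: "\<pi> \<in> label_weights k" and P: "P \<in> prob_matrices k"
  shows "pmf (sbm_network k \<pi> P n) x = likelihood k n \<pi> P x"
proof -
  define Z where "Z = Pi_pmf {1..n} undefined (\<lambda>_. label_pmf k \<pi>)"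
  define E where "E = (\<lambda>z. Pi_pmf (node_pairs n) False (\<lambda>(i, j). bernoulli_pmf (P (z i) (z j))))"
  have Z: "pmf Z z = label_likelihood k n \<pi> z" if "z \<in> {1..n} \<rightarrow>\<^sub>E {1..k}" for z
  proof -
    \<comment> \<open>The default \<open>undefined\<close> of the label law is the value that an
      extensional function takes off \<open>{1..n}\<close>, so the support lies in the
      \<open>PiE\<close> set over which the likelihood sums.\<close>
    have "pmf Z z = (\<Prod>i=1..n. pmf (label_pmf k \<pi>) (z i))"
      unfolding Z_def using that by (intro pmf_Pi') (auto simp: PiE_iff extensional_def)
    also have "\<dots> = (\<Prod>i=1..n. \<pi> (z i))"
      using that by (intro prod.cong) (auto simp: pmf_label_pmf[OF \<pi>] PiE_iff)
    finally show ?thesis using that by (simp add: label_likelihood_eq_prod)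
  qed
  have supp: "z \<in> {1..n} \<rightarrow>\<^sub>E {1..k}" if "z \<in> set_pmf Z" for z
  proof -
    have "set_pmf (label_pmf k \<pi>) \<subseteq> {1..k}"
      by (auto simp: set_pmf_eq pmf_label_pmf[OF \<pi>] split: if_splits)
    then show ?thesis
      using that by (force simp: Z_def set_Pi_pmf PiE_dflt_def PiE_iff extensional_def)
  qed
  have "sbm_network k \<pi> P n = bind_pmf Z (\<lambda>z. map_pmf network_of_edges (E z))"
    unfolding sbm_network_def sbm_def Z_def E_def
    by (simp add: map_bind_pmf map_pmf_def bind_assoc_pmf bind_return_pmf)
  then have "pmf (sbm_network k \<pi> P n) x = (LINT z|Z. pmf (map_pmf network_of_edges (E z)) x)"
    by (simp add: pmf_bind)
  also have "\<dots> = (\<Sum>z\<in>{1..n} \<rightarrow>\<^sub>E {1..k}. pmf (map_pmf network_of_edges (E z)) x * pmf Z z)"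
    using supp by (intro integral_measure_pmf_real finite_labelings) auto
  also have "\<dots> = likelihood k n \<pi> P x"
    unfolding likelihood_def E_def by (intro sum.cong refl) (simp add: Z pmf_network_of_edges[OF x _ P])
  finally show ?thesis .
qed

lemma prob_sbm_network:
  assumes "B \<subseteq> networks n" "\<pi> \<in> label_weights k" "P \<in> prob_matrices k"
  shows "measure_pmf.prob (sbm_network k \<pi> P n) B = (\<Sum>x\<in>B. likelihood k n \<pi> P x)"
  using assms finite_subset[OF assms(1)]
  by (auto simp: measure_measure_pmf_finite pmf_sbm_network subset_iff intro!: sum.cong)

section \<open>Overestimation\<close>

lemma card_class_pairs: "real (card (class_pairs k)) = real k * (real k + 1) / 2"
proof (induction k)
  case 0
  have "class_pairs 0 = {}" by (auto simp: class_pairs_def)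
  then show ?case by simp
next
  case (Suc k)
  have "class_pairs (Suc k) = class_pairs k \<union> (\<lambda>a. (a, Suc k)) ` {1..Suc k}"
    by (auto simp: class_pairs_def)
  moreover have "card ((\<lambda>a. (a, Suc k)) ` {1..Suc k}) = Suc k"
    by (subst card_image) (auto simp: inj_on_def)
  moreover have "class_pairs k \<inter> (\<lambda>a. (a, Suc k)) ` {1..Suc k} = {}"
    by (auto simp: class_pairs_def)
  ultimately have "card (class_pairs (Suc k)) = card (class_pairs k) + Suc k"
    by (simp add: card_Un_disjoint del: Un_insert_right)
  then show ?case using Suc by (simp add: field_simps)
qed

section \<open>Bounds for the maximum likelihood and its sum\<close>

lemma likelihood_nonneg:
  "\<pi> \<in> label_weights k \<Longrightarrow> P \<in> prob_matrices k \<Longrightarrow> likelihood k n \<pi> P x \<ge> 0"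
  unfolding likelihood_def
  by (intro sum_nonneg mult_nonneg_nonneg cond_likelihood_nonneg label_likelihood_nonneg)

lemma likelihood_le_one:
  assumes "\<pi> \<in> label_weights k" "P \<in> prob_matrices k" "x \<in> networks n"
  shows "likelihood k n \<pi> P x \<le> 1"
proof -
  have "likelihood k n \<pi> P x \<le> (\<Sum>x\<in>networks n. likelihood k n \<pi> P x)"
    using assms by (intro member_le_sum likelihood_nonneg) auto
  then show ?thesis using sum_likelihood[OF assms(1,2)] by simp
qed

lemma bdd_above_likelihood:
  "x \<in> networks n \<Longrightarrow>
     bdd_above ((\<lambda>(\<pi>, P). likelihood k n \<pi> P x) ` (label_weights k \<times> prob_matrices k))"
  by (rule bdd_aboveI[where M = 1]) (auto intro: likelihood_le_one)

lemma likelihood_le_max_likelihood: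
  assumes "\<pi> \<in> label_weights k" "P \<in> prob_matrices k" "x \<in> networks n"
  shows "likelihood k n \<pi> P x \<le> max_likelihood k n x"
  using assms cSUP_upper[OF _ bdd_above_likelihood[OF assms(3), of k], of "(\<pi>, P)"]
  unfolding max_likelihood_def by simp

text \<open>Together with the constant matrix \<open>1/2\<close> this is a reference point at which
  every network has positive likelihood. It makes the supremum range over a nonempty set, the
  maximum likelihood positive and the Shtarkov sum at least 1.\<close>

lemma uniform_label_weights: "k \<ge> 1 \<Longrightarrow> (\<lambda>_. 1 / real k) \<in> label_weights k"
  by (auto simp: label_weights_def)

lemma half_prob_matrices: "(\<lambda>_ _. 1 / 2) \<in> prob_matrices k"
  by (auto simp: prob_matrices_def)

lemma max_likelihood_least:
  assumes "k \<ge> 1" "\<And>\<pi> P. \<pi> \<in> label_weights k \<Longrightarrow> P \<in> prob_matrices k \<Longrightarrow> likelihood k n \<pi> P x \<le> B"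
  shows "max_likelihood k n x \<le> B"
  unfolding max_likelihood_def
  using assms uniform_label_weights[OF assms(1)] half_prob_matrices[of k]
  by (intro cSUP_least) auto

lemma max_likelihood_pos:
  assumes "k \<ge> 1" "x \<in> networks n"
  shows "max_likelihood k n x > 0"
proof -
  have "likelihood k n (\<lambda>_. 1 / real k) (\<lambda>_ _. 1 / 2) x > 0"
    unfolding likelihood_def cond_likelihood_altdef label_likelihood_def using assms(1)
    by (intro sum_pos mult_pos_pos prod_pos) (auto simp: PiE_eq_empty_iff)
  also have "\<dots> \<le> max_likelihood k n x"
    by (rule likelihood_le_max_likelihood[OF uniform_label_weights[OF assms(1)] half_prob_matrices assms(2)])
  finally show ?thesis .
qed

lemma sum_max_likelihood_ge:
  assumes "k \<ge> 1"
  shows "(\<Sum>x\<in>networks n. max_likelihood k n x) \<ge> 1"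
proof -
  have "1 = (\<Sum>x\<in>networks n. likelihood k n (\<lambda>_. 1 / real k) (\<lambda>_ _. 1 / 2) x)"
    by (rule sum_likelihood[symmetric, OF uniform_label_weights[OF assms] half_prob_matrices])
  also have "\<dots> \<le> (\<Sum>x\<in>networks n. max_likelihood k n x)"
    by (intro sum_mono likelihood_le_max_likelihood uniform_label_weights[OF assms] half_prob_matrices)
  finally show ?thesis .
qed

section \<open>The Shtarkov sum, with one mixture per block and one for the labels\<close>

definition kt_edges :: "nat \<Rightarrow> nat \<Rightarrow> (nat \<Rightarrow> nat) \<Rightarrow> (nat \<times> nat \<Rightarrow> nat) \<Rightarrow> real" where
  "kt_edges k n z g =
     (\<Prod>c\<in>class_pairs k. kt_weight {0, 1} (\<lambda>y. card {p \<in> node_pairs n. pair_class z p = c \<and> g p = y}))"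

lemma sum_kt_edges:
  assumes "z \<in> {1..n} \<rightarrow>\<^sub>E {1..k}"
  shows "(\<Sum>x\<in>networks n. kt_edges k n z (edge x)) = 1"
proof -
  have "(\<Sum>x\<in>networks n. kt_edges k n z (edge x)) =
      (\<Sum>g\<in>node_pairs n \<rightarrow>\<^sub>E {0, 1}. kt_edges k n z (edge (network_of n g)))"
    by (rule sum.reindex_bij_betw[OF bij_betw_network_of, symmetric])
  also have "\<dots> = (\<Sum>g\<in>node_pairs n \<rightarrow>\<^sub>E {0, 1}. kt_edges k n z g)"
  proof (rule sum.cong[OF refl])
    fix g
    have "{p \<in> node_pairs n. pair_class z p = c \<and> edge (network_of n g) p = y} =
        {p \<in> node_pairs n. pair_class z p = c \<and> g p = y}" for c y
      by (auto simp: edge_network_of)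
    then show "kt_edges k n z (edge (network_of n g)) = kt_edges k n z g"
      by (simp add: kt_edges_def)
  qed
  also have "\<dots> = 1"
    unfolding kt_edges_def
    using pair_class_in_class_pairs[OF assms] by (intro sum_prod_kt_weight) auto
  finally show ?thesis .
qed

lemma kt_edges_nonneg: "kt_edges k n z g \<ge> 0"
  unfolding kt_edges_def by (intro prod_nonneg ballI kt_weight_nonneg)

text \<open>A block is a binary sequence, so comparison with its mixture costs the square root of
  its length. The length is at most \<open>n * n\<close>, whence one factor of order
  \<open>n\<close> per block.\<close>

lemma cond_likelihood_le_kt:
  obtains C where "C > 0"
    "\<And>n P x z. x \<in> networks n \<Longrightarrow> P \<in> prob_matrices k \<Longrightarrow>
       cond_likelihood k n P x z \<le> (C * real (Suc n)) ^ card (class_pairs k) * kt_edges k n z (edge x)"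
proof -
  obtain C where C: "C > 0" "\<And>(p :: nat \<Rightarrow> real) m. (\<And>a. a \<in> {0, 1} \<Longrightarrow> p a \<ge> 0) \<Longrightarrow> (\<Sum>a\<in>{0, 1}. p a) = 1 \<Longrightarrow>
       (\<Prod>a\<in>{0, 1}. p a ^ m a) \<le>
         C * real (Suc (\<Sum>a\<in>{0, 1}. m a)) powr ((real (card {0 :: nat, 1}) - 1) / 2) * kt_weight {0, 1} m"
    by (rule prod_power_le_kt_weight[of "{0, 1 :: nat}"]) auto
  show ?thesis
  proof (rule that[OF C(1)])
    fix n P x z assume x: "x \<in> networks n" and P: "P \<in> prob_matrices k"
    have "cond_likelihood k n P x z \<le> (\<Prod>c\<in>class_pairs k. C * real (Suc n) *
        kt_weight {0, 1} (\<lambda>y. card {p \<in> node_pairs n. pair_class z p = c \<and> edge x p = y}))"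
      unfolding cond_likelihood_altdef
    proof (intro prod_mono, clarify, intro conjI)
      fix a b assume ab: "(a, b) \<in> class_pairs k"
      then have le: "a \<le> b" by (simp add: class_pairs_def)
      have P01: "0 \<le> P a b" "P a b \<le> 1" using P ab by (auto simp: prob_matrices_def class_pairs_def)
      then show "0 \<le> P a b ^ edge_count n x z a b * (1 - P a b) ^ (pair_count n z a b - edge_count n x z a b)"
        by simp
      define m where "m = (\<lambda>y. card {p \<in> node_pairs n. pair_class z p = (a, b) \<and> edge x p = y})"
      have m: "m 1 = edge_count n x z a b" "m 0 = pair_count n z a b - edge_count n x z a b"
        using edge_count_eq_card[OF x le] pair_count_diff_edge_count[OF x le] by (simp_all add: m_def)
      have "m 0 + m 1 = pair_count n z a b"
        using edge_count_le_pair_count[OF x le, of z] unfolding m by simp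
      then have "real (Suc (m 0 + m 1)) \<le> real (Suc n) ^ 2"
        using pair_count_le[OF le, of n z]
        by (simp add: power2_eq_square del: of_nat_Suc flip: of_nat_mult)
      then have sq: "real (Suc (m 0 + m 1)) powr (1/2) \<le> real (Suc n)"
        by (simp add: powr_half_sqrt real_le_lsqrt)
      have "P a b ^ edge_count n x z a b * (1 - P a b) ^ (pair_count n z a b - edge_count n x z a b) =
          (\<Prod>y\<in>{0, 1}. bern_weight (P a b) y ^ m y)"
        by (simp only: m(2)[symmetric]) (simp add: bern_weight_def m(1)[symmetric])
      also have "\<dots> \<le> C * real (Suc (\<Sum>y\<in>{0, 1}. m y)) powr ((real (card {0 :: nat, 1}) - 1) / 2) * kt_weight {0, 1} m"
        using P01 by (intro C(2)) (auto simp: bern_weight_def)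
      also have "\<dots> = C * real (Suc (m 0 + m 1)) powr (1/2) * kt_weight {0, 1} m" by simp
      also have "\<dots> \<le> C * real (Suc n) * kt_weight {0, 1} m"
        using sq C(1) by (intro mult_right_mono mult_left_mono kt_weight_nonneg) auto
      finally show "P a b ^ edge_count n x z a b * (1 - P a b) ^ (pair_count n z a b - edge_count n x z a b)
          \<le> C * real (Suc n) * kt_weight {0, 1} (\<lambda>y. card {p \<in> node_pairs n. pair_class z p = (a, b) \<and> edge x p = y})"
        by (simp add: m_def)
    qed
    also have "\<dots> = (C * real (Suc n)) ^ card (class_pairs k) * kt_edges k n z (edge x)"
      by (simp only: prod.distrib prod_constant kt_edges_def power_mult_distrib)
    finally show "cond_likelihood k n P x z \<le> (C * real (Suc n)) ^ card (class_pairs k) * kt_edges k n z (edge x)" .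
  qed
qed

lemma sum_node_count:
  assumes "z \<in> {1..n} \<rightarrow>\<^sub>E {1..k}"
  shows "(\<Sum>a=1..k. node_count n z a) = n"
proof -
  have "(\<Sum>a=1..k. node_count n z a) = (\<Sum>a\<in>{1..k}. \<Sum>i\<in>{i\<in>{1..n}. z i = a}. 1)"
    by (simp add: node_count_eq_card)
  also have "\<dots> = (\<Sum>i=1..n. 1)"
    using assms by (intro sum.group) auto
  finally show ?thesis by simp
qed

lemma label_likelihood_le_kt:
  assumes "k \<ge> 1"
  obtains C where "C > 0"
    "\<And>n \<pi> z. \<pi> \<in> label_weights k \<Longrightarrow> z \<in> {1..n} \<rightarrow>\<^sub>E {1..k} \<Longrightarrow>
       label_likelihood k n \<pi> z \<le> C * real (Suc n) powr ((real k - 1) / 2) * kt_weight {1..k} (node_count n z)"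
proof -
  obtain C where C: "C > 0" "\<And>(p :: nat \<Rightarrow> real) m. (\<And>a. a \<in> {1..k} \<Longrightarrow> p a \<ge> 0) \<Longrightarrow> (\<Sum>a\<in>{1..k}. p a) = 1 \<Longrightarrow>
       (\<Prod>a\<in>{1..k}. p a ^ m a) \<le>
         C * real (Suc (\<Sum>a\<in>{1..k}. m a)) powr ((real (card {1..k}) - 1) / 2) * kt_weight {1..k} m"
    by (rule prod_power_le_kt_weight[of "{1..k}"]) (use assms in auto)
  show ?thesis
  proof (rule that[OF C(1)])
    fix n :: nat and \<pi> z assume "\<pi> \<in> label_weights k" and z: "z \<in> {1..n} \<rightarrow>\<^sub>E {1..k}"
    then have \<pi>: "\<And>a. a \<in> {1..k} \<Longrightarrow> \<pi> a \<ge> 0" "(\<Sum>a\<in>{1..k}. \<pi> a) = 1"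
      unfolding label_weights_def using less_imp_le by blast+
    show "label_likelihood k n \<pi> z \<le> C * real (Suc n) powr ((real k - 1) / 2) * kt_weight {1..k} (node_count n z)"
      using C(2)[OF \<pi>, of "node_count n z"] unfolding sum_node_count[OF z] label_likelihood_def by simp
  qed
qed

lemma sum_kt_labels:
  assumes "k \<ge> 1"
  shows "(\<Sum>z\<in>{1..n} \<rightarrow>\<^sub>E {1..k}. kt_weight {1..k} (node_count n z)) = 1"
proof -
  have "(\<Sum>z\<in>{1..n} \<rightarrow>\<^sub>E {1..k}. \<Prod>d\<in>{()}. kt_weight {1..k} (\<lambda>a. card {i\<in>{1..n}. () = d \<and> z i = a})) = 1"
    using assms by (intro sum_prod_kt_weight) auto
  then show ?thesis by (simp add: node_count_eq_card[abs_def])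
qed

text \<open>The mixture bound contains neither \<open>\<pi>\<close> nor \<open>P\<close>, so it
  holds for the supremum. Summed over networks and then labelings the mixtures give 1, and only the
  prefactors remain: exponent \<open>k (k + 1) / 2\<close> from the blocks and
  \<open>(k - 1) / 2\<close> from the labels.\<close>

lemma sum_max_likelihood_le:
  assumes "k \<ge> 1"
  obtains C where "C > 0"
    "\<And>n. (\<Sum>x\<in>networks n. max_likelihood k n x) \<le> C * real (Suc n) powr ((real k * (real k + 2) - 1) / 2)"
proof -
  obtain C1 where C1: "C1 > 0" "\<And>n P x z. x \<in> networks n \<Longrightarrow> P \<in> prob_matrices k \<Longrightarrow>
       cond_likelihood k n P x z \<le> (C1 * real (Suc n)) ^ card (class_pairs k) * kt_edges k n z (edge x)"
    by (rule cond_likelihood_le_kt) blast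
  obtain C2 where C2: "C2 > 0" "\<And>n \<pi> z. \<pi> \<in> label_weights k \<Longrightarrow> z \<in> {1..n} \<rightarrow>\<^sub>E {1..k} \<Longrightarrow>
       label_likelihood k n \<pi> z \<le> C2 * real (Suc n) powr ((real k - 1) / 2) * kt_weight {1..k} (node_count n z)"
    by (rule label_likelihood_le_kt[OF assms]) blast
  define C where "C = C1 ^ card (class_pairs k) * C2"
  show ?thesis
  proof (rule that[of C])
    show "C > 0" using C1 C2 by (simp add: C_def)
    fix n
    define B1 where "B1 = (C1 * real (Suc n)) ^ card (class_pairs k)"
    define B2 where "B2 = C2 * real (Suc n) powr ((real k - 1) / 2)"
    have B: "B1 \<ge> 0" "B2 \<ge> 0" using C1 C2 by (auto simp: B1_def B2_def)
    have max_le: "max_likelihood k n x \<le> (\<Sum>z\<in>{1..n} \<rightarrow>\<^sub>E {1..k}.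
        (B1 * kt_edges k n z (edge x)) * (B2 * kt_weight {1..k} (node_count n z)))"
      if x: "x \<in> networks n" for x
    proof (rule max_likelihood_least[OF assms])
      fix \<pi> P assume \<pi>P: "\<pi> \<in> label_weights k" "P \<in> prob_matrices k"
      show "likelihood k n \<pi> P x \<le> (\<Sum>z\<in>{1..n} \<rightarrow>\<^sub>E {1..k}.
        (B1 * kt_edges k n z (edge x)) * (B2 * kt_weight {1..k} (node_count n z)))"
        unfolding likelihood_def B1_def B2_def
        using C1 \<pi>P x
        by (intro sum_mono mult_mono C1(2) C2(2) label_likelihood_nonneg mult_nonneg_nonneg kt_edges_nonneg) auto
    qed
    have "(\<Sum>x\<in>networks n. max_likelihood k n x) \<le> (\<Sum>x\<in>networks n. \<Sum>z\<in>{1..n} \<rightarrow>\<^sub>E {1..k}.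
        (B1 * kt_edges k n z (edge x)) * (B2 * kt_weight {1..k} (node_count n z)))"
      by (intro sum_mono max_le)
    also have "\<dots> = (\<Sum>z\<in>{1..n} \<rightarrow>\<^sub>E {1..k}. \<Sum>x\<in>networks n.
        (B1 * B2 * kt_weight {1..k} (node_count n z)) * kt_edges k n z (edge x))"
      by (subst sum.swap) (simp add: mult_ac)
    also have "\<dots> = (\<Sum>z\<in>{1..n} \<rightarrow>\<^sub>E {1..k}. B1 * B2 * kt_weight {1..k} (node_count n z))"
      by (intro sum.cong refl) (simp only: sum_distrib_left[symmetric] sum_kt_edges mult_1_right)
    also have "\<dots> = B1 * B2"
      by (simp only: sum_distrib_left[symmetric] sum_kt_labels[OF assms] mult_1_right)
    also have "\<dots> = C * (real (Suc n) ^ card (class_pairs k) * real (Suc n) powr ((real k - 1) / 2))"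
      by (simp add: B1_def B2_def C_def power_mult_distrib)
    also have "real (Suc n) ^ card (class_pairs k) = real (Suc n) powr (real k * (real k + 1) / 2)"
      by (simp only: card_class_pairs[symmetric] powr_realpow[of "real (Suc n)", OF of_nat_0_less_iff[THEN iffD2, OF zero_less_Suc]])
    also have "\<dots> * real (Suc n) powr ((real k - 1) / 2) = real (Suc n) powr ((real k * (real k + 2) - 1) / 2)"
    proof -
      have "real k * (real k + 1) / 2 + (real k - 1) / 2 = (real k * (real k + 2) - 1) / 2"
        by (simp add: field_simps)
      then show ?thesis by (simp only: powr_add[symmetric])
    qed
    finally show "(\<Sum>x\<in>networks n. max_likelihood k n x) \<le> C * real (Suc n) powr ((real k * (real k + 2) - 1) / 2)" .
  qed
qed

lemma sum_UN_le:
  fixes f :: "'a \<Rightarrow> real"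
  assumes "finite I" "\<And>i. i \<in> I \<Longrightarrow> finite (B i)" "\<And>i x. i \<in> I \<Longrightarrow> x \<in> B i \<Longrightarrow> f x \<ge> 0"
  shows "sum f (\<Union>i\<in>I. B i) \<le> (\<Sum>i\<in>I. sum f (B i))"
  using assms
proof (induction I rule: finite_induct)
  case (insert i I)
  have "sum f (B i \<union> (\<Union>i\<in>I. B i)) + sum f (B i \<inter> (\<Union>i\<in>I. B i)) = sum f (B i) + sum f (\<Union>i\<in>I. B i)"
    using insert by (intro sum.union_inter) auto
  moreover have "sum f (B i \<inter> (\<Union>i\<in>I. B i)) \<ge> 0"
    using insert.prems by (intro sum_nonneg) auto
  moreover have "sum f (\<Union>i\<in>I. B i) \<le> (\<Sum>i\<in>I. sum f (B i))"
    using insert by auto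
  ultimately show ?case using insert.hyps by simp
qed simp

section \<open>The criterion and the probability of overestimation\<close>

definition nml_criterion :: "real \<Rightarrow> nat \<Rightarrow> network \<Rightarrow> nat \<Rightarrow> real" where
  "nml_criterion \<epsilon> n x k = ln (NML k n x) - pen \<epsilon> k n"

lemma NML_pos: "k \<ge> 1 \<Longrightarrow> x \<in> networks n \<Longrightarrow> NML k n x > 0"
  using sum_max_likelihood_ge[of k n] max_likelihood_pos[of k x n] by (simp add: NML_def)

lemma sum_NML: "k \<ge> 1 \<Longrightarrow> (\<Sum>x\<in>networks n. NML k n x) = 1"
  using sum_max_likelihood_ge[of k n] by (simp add: NML_def sum_divide_distrib[symmetric])

lemma NML_le_of_criterion_le:
  assumes "nml_criterion \<epsilon> n x k \<le> nml_criterion \<epsilon> n x l" "k \<ge> 1" "l \<ge> 1" "x \<in> networks n"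
  shows "NML k n x \<le> exp (pen \<epsilon> k n - pen \<epsilon> l n) * NML l n x"
proof -
  have "exp (ln (NML k n x)) \<le> exp (pen \<epsilon> k n - pen \<epsilon> l n + ln (NML l n x))"
    using assms(1) unfolding nml_criterion_def by (subst exp_le_cancel_iff) simp
  then show ?thesis using NML_pos[OF assms(2,4)] NML_pos[OF assms(3,4)] by (simp add: exp_add)
qed

text \<open>Passing to \<open>Suc k\<close> costs exactly the summand of index \<open>k\<close>. Any
  larger order also pays the summand of index \<open>Suc k\<close>, which is at least
  \<open>ln n\<close>; the resulting \<open>1 / n\<close> compensates for the number of such
  orders.\<close>

lemma exp_pen_diff_le:
  assumes "1 \<le> k" "k < l" "n \<ge> 1" "\<epsilon> > 0"
  shows "exp (pen \<epsilon> k n - pen \<epsilon> l n) \<le>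
    real n powr - ((real k * (real k + 2) + 1 + \<epsilon>) / 2) * (if l = Suc k then 1 else 1 / real n)"
proof -
  define t where "t = (\<lambda>i. (real i * (real i + 2) + 1 + \<epsilon>) / 2 * ln (real n))"
  have t: "t i \<ge> 0" for i using assms by (auto simp: t_def)
  have pen: "pen \<epsilon> m n = sum t {1..m - 1}" for m by (simp add: pen_def t_def)
  have "pen \<epsilon> k n + (t k + (if l = Suc k then 0 else ln (real n))) \<le> pen \<epsilon> l n"
  proof (cases "l = Suc k")
    case True
    then show ?thesis using assms(1) by (cases k) (auto simp: pen)
  next
    case False
    have "ln (real n) \<le> t (Suc k)"
    proof -
      have "1 * ln (real n) \<le> t (Suc k)" unfolding t_def
        using assms by (intro mult_right_mono) (auto simp: field_simps intro!: add_nonneg_nonneg)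
      then show ?thesis by simp
    qed
    then have "pen \<epsilon> k n + (t k + ln (real n)) \<le> sum t {1..k - 1} + (t k + t (Suc k))"
      by (simp add: pen)
    also have "\<dots> = sum t {1..Suc k}"
      using assms(1) by (cases k) auto
    also have "\<dots> \<le> pen \<epsilon> l n"
      unfolding pen using assms False by (intro sum_mono2 t) auto
    finally show ?thesis using False by simp
  qed
  then have "exp (pen \<epsilon> k n - pen \<epsilon> l n) \<le> exp (- (t k + (if l = Suc k then 0 else ln (real n))))"
    by simp
  also have "\<dots> = exp (- t k) * (if l = Suc k then 1 else 1 / real n)"
    using assms(3) by (simp add: exp_add exp_minus exp_diff field_simps)
  also have "exp (- t k) = real n powr - ((real k * (real k + 2) + 1 + \<epsilon>) / 2)"
    using assms(3) by (simp add: t_def powr_def)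
  finally show ?thesis .
qed

text \<open>The constant is independent of \<open>P\<close> because the true matrix changes with
  \<open>n\<close>. The penalty exponent \<open>a\<close> exceeds the Shtarkov exponent
  \<open>e\<close> by exactly \<open>1 + \<epsilon> / 2\<close>. The event includes ties.\<close>

lemma overestimation_prob_le:
  assumes k: "1 \<le> k" and \<epsilon>: "\<epsilon> > 0" and \<pi>: "\<pi> \<in> label_weights k"
  obtains C where "C > 0"
    "\<And>n P. n \<ge> 1 \<Longrightarrow> P \<in> prob_matrices k \<Longrightarrow>
      (\<Sum>x\<in>{x\<in>networks n. \<exists>l\<in>{k<..n}. nml_criterion \<epsilon> n x k \<le> nml_criterion \<epsilon> n x l}.
         likelihood k n \<pi> P x) \<le> C * real n powr - (1 + \<epsilon> / 2)"
proof -
  define e where "e = (real k * (real k + 2) - 1) / 2"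
  have "1 * 2 \<le> real k * (real k + 2)" using k by (intro mult_mono) auto
  then have e: "e \<ge> 0" by (simp add: e_def)
  obtain C where C: "C > 0" "\<And>n. (\<Sum>x\<in>networks n. max_likelihood k n x) \<le> C * real (Suc n) powr e"
    unfolding e_def by (rule sum_max_likelihood_le[OF k]) blast
  show ?thesis
  proof (rule that[of "2 * C * 2 powr e"])
    show "2 * C * 2 powr e > 0" using C by simp
    fix n P assume n: "n \<ge> (1::nat)" and P: "P \<in> prob_matrices k"
    define S where "S = (\<Sum>x\<in>networks n. max_likelihood k n x)"
    have S: "S \<ge> 1" unfolding S_def by (rule sum_max_likelihood_ge[OF k])
    define B where "B = (\<lambda>l. {x\<in>networks n. nml_criterion \<epsilon> n x k \<le> nml_criterion \<epsilon> n x l})"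
    define a where "a = (real k * (real k + 2) + 1 + \<epsilon>) / 2"
    have one: "(\<Sum>x\<in>B l. likelihood k n \<pi> P x) \<le> S * real n powr - a * (if l = Suc k then 1 else 1 / real n)"
      if l: "k < l" for l
    proof -
      have "(\<Sum>x\<in>B l. likelihood k n \<pi> P x) \<le> (\<Sum>x\<in>B l. S * (exp (pen \<epsilon> k n - pen \<epsilon> l n) * NML l n x))"
      proof (rule sum_mono)
        fix x assume x: "x \<in> B l"
        then have xn: "x \<in> networks n" by (simp add: B_def)
        have "likelihood k n \<pi> P x \<le> S * NML k n x"
          using likelihood_le_max_likelihood[OF \<pi> P xn] S by (simp add: NML_def S_def[symmetric])
        also have "\<dots> \<le> S * (exp (pen \<epsilon> k n - pen \<epsilon> l n) * NML l n x)"
          using x k l S by (intro mult_left_mono NML_le_of_criterion_le) (auto simp: B_def)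
        finally show "likelihood k n \<pi> P x \<le> S * (exp (pen \<epsilon> k n - pen \<epsilon> l n) * NML l n x)" .
      qed
      also have "\<dots> \<le> (\<Sum>x\<in>networks n. S * (exp (pen \<epsilon> k n - pen \<epsilon> l n) * NML l n x))"
        using S k l by (intro sum_mono2) (auto simp: B_def intro!: mult_nonneg_nonneg less_imp_le[OF NML_pos])
      \<comment> \<open>The change of measure pays off here: \<open>NML l n\<close> is a probability
        distribution for every \<open>l\<close>, so no estimate of the larger model enters.\<close>
      also have "\<dots> = S * exp (pen \<epsilon> k n - pen \<epsilon> l n)"
        using k l by (simp only: sum_distrib_left[symmetric] sum_NML)
      also have "\<dots> \<le> S * (real n powr - a * (if l = Suc k then 1 else 1 / real n))"
        unfolding a_def using exp_pen_diff_le[OF k l n \<epsilon>] S by (intro mult_left_mono) auto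
      finally show ?thesis by simp
    qed
    have "(\<Sum>x\<in>{x\<in>networks n. \<exists>l\<in>{k<..n}. nml_criterion \<epsilon> n x k \<le> nml_criterion \<epsilon> n x l}. likelihood k n \<pi> P x)
        = (\<Sum>x\<in>(\<Union>l\<in>{k<..n}. B l). likelihood k n \<pi> P x)"
      by (intro sum.cong) (auto simp: B_def)
    also have "\<dots> \<le> (\<Sum>l\<in>{k<..n}. \<Sum>x\<in>B l. likelihood k n \<pi> P x)"
      using \<pi> P by (intro sum_UN_le) (auto simp: B_def intro: likelihood_nonneg)
    also have "\<dots> \<le> (\<Sum>l\<in>{k<..n}. S * real n powr - a * (if l = Suc k then 1 else 1 / real n))"
      by (intro sum_mono one) auto
    also have "\<dots> = S * real n powr - a * (\<Sum>l\<in>{k<..n}. (if l = Suc k then 1 else 1 / real n))"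
      by (simp only: sum_distrib_left)
    also have "\<dots> \<le> S * real n powr - a * 2"
    proof (rule mult_left_mono)
      \<comment> \<open>The order \<open>Suc k\<close> contributes 1, and at most \<open>n\<close>
        other orders contribute \<open>1 / n\<close> each.\<close>
      have "(\<Sum>l\<in>{k<..n}. (if l = Suc k then 1 else 1 / real n)) \<le>
          (\<Sum>l\<in>{k<..n}. (if l = Suc k then 1 else 0) + 1 / real n)"
        by (intro sum_mono) auto
      also have "\<dots> \<le> 1 + real (n - k) / real n"
        by (simp add: sum.distrib)
      also have "\<dots> \<le> 2" using n by simp
      finally show "(\<Sum>l\<in>{k<..n}. (if l = Suc k then 1 else 1 / real n)) \<le> 2" .
    qed (use S in auto)
    also have "\<dots> \<le> (C * (2 * real n) powr e) * real n powr - a * 2"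
    proof -
      have "S \<le> C * real (Suc n) powr e" unfolding S_def by (rule C(2))
      also have "\<dots> \<le> C * (2 * real n) powr e"
        using C(1) n e by (intro mult_left_mono powr_mono2) auto
      finally show ?thesis by (intro mult_right_mono) auto
    qed
    also have "\<dots> = 2 * C * 2 powr e * (real n powr e * real n powr - a)"
      using n by (simp add: powr_mult)
    also have "real n powr e * real n powr - a = real n powr - (1 + \<epsilon> / 2)"
    proof -
      have "e + - a = - (1 + \<epsilon> / 2)" by (simp add: e_def a_def field_simps)
      then show ?thesis by (simp only: powr_add[symmetric])
    qed
    finally show "(\<Sum>x\<in>{x\<in>networks n. \<exists>l\<in>{k<..n}. nml_criterion \<epsilon> n x k \<le> nml_criterion \<epsilon> n x l}.
         likelihood k n \<pi> P x) \<le> 2 * C * 2 powr e * real n powr - (1 + \<epsilon> / 2)" .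
  qed
qed

section \<open>Underestimation\<close>

text \<open>Twice the coefficient is 2 minus the two squared differences of square roots. The one
  for the non-edges is dropped: for small \<open>p\<close> and \<open>q\<close> it is of second
  order, whereas the one for the edges is of first order.\<close>

lemma bhattacharyya_le:
  fixes p q :: real
  assumes "0 \<le> p" "p \<le> 1" "0 \<le> q" "q \<le> 1"
  shows "sqrt ((1 - p) * (1 - q)) + sqrt (p * q) \<le> exp (- (1/2) * (sqrt p - sqrt q)\<^sup>2)"
proof -
  have "2 * (sqrt ((1 - p) * (1 - q)) + sqrt (p * q)) =
      2 - (sqrt p - sqrt q)\<^sup>2 - (sqrt (1 - p) - sqrt (1 - q))\<^sup>2"
    using assms by (simp add: power2_diff real_sqrt_mult)
  also have "\<dots> \<le> 2 - (sqrt p - sqrt q)\<^sup>2" by simp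
  finally have "sqrt ((1 - p) * (1 - q)) + sqrt (p * q) \<le> 1 + - (1/2) * (sqrt p - sqrt q)\<^sup>2"
    by simp
  also have "\<dots> \<le> exp (- (1/2) * (sqrt p - sqrt q)\<^sup>2)" by (rule exp_ge_add_one_self)
  finally show ?thesis .
qed

lemma sqrt_prod: "finite A \<Longrightarrow> sqrt (prod f A) = (\<Prod>x\<in>A. sqrt (f x))"
  by (induction A rule: finite_induct) (auto simp: real_sqrt_mult)

lemma sqrt_sum_le:
  "finite A \<Longrightarrow> (\<And>x. x \<in> A \<Longrightarrow> f x \<ge> 0) \<Longrightarrow> sqrt (sum f A) \<le> (\<Sum>x\<in>A. sqrt (f x))"
proof (induction A rule: finite_induct)
  case (insert a A)
  have "sqrt (f a + sum f A) \<le> sqrt (f a) + sqrt (sum f A)"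
    using insert by (intro sqrt_add_le_add_sqrt sum_nonneg) auto
  moreover have "sqrt (sum f A) \<le> (\<Sum>x\<in>A. sqrt (f x))"
    using insert by auto
  ultimately show ?case using insert.hyps by simp
qed simp

lemma prob_matrices_label:
  assumes "P \<in> prob_matrices k" "z \<in> {1..n} \<rightarrow>\<^sub>E {1..k}" "i \<in> {1..n}" "j \<in> {1..n}"
  shows "0 \<le> P (z i) (z j)" "P (z i) (z j) \<le> 1" "P (z i) (z j) = P (z j) (z i)"
proof -
  have "z i \<in> {1..k}" "z j \<in> {1..k}" using PiE_mem[OF assms(2)] assms(3,4) by blast+
  then show "0 \<le> P (z i) (z j)" "P (z i) (z j) \<le> 1" "P (z i) (z j) = P (z j) (z i)"
    using assms(1) unfolding prob_matrices_def by blast+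
qed

text \<open>Given labels, both laws are products over the same node pairs, so their Bhattacharyya
  coefficient is the product of the coefficients of the pairs. The two models may have different
  numbers of communities.\<close>

lemma sum_sqrt_cond_likelihood_le:
  assumes P: "P \<in> prob_matrices k" "z \<in> {1..n} \<rightarrow>\<^sub>E {1..k}"
    and P': "P' \<in> prob_matrices k'" "z' \<in> {1..n} \<rightarrow>\<^sub>E {1..k'}"
  shows "(\<Sum>x\<in>networks n. sqrt (cond_likelihood k n P x z * cond_likelihood k' n P' x z')) \<le>
    exp (- (1/2) * (\<Sum>(i, j)\<in>node_pairs n. (sqrt (P (z i) (z j)) - sqrt (P' (z' i) (z' j)))\<^sup>2))"
proof -
  let ?p = "\<lambda>p. P (z (fst p)) (z (snd p))" and ?q = "\<lambda>p. P' (z' (fst p)) (z' (snd p))"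
  have "(\<Sum>x\<in>networks n. sqrt (cond_likelihood k n P x z * cond_likelihood k' n P' x z')) =
      (\<Sum>x\<in>networks n. \<Prod>p\<in>node_pairs n. sqrt (bern_weight (?p p) (edge x p) * bern_weight (?q p) (edge x p)))"
  proof (rule sum.cong[OF refl])
    fix x assume x: "x \<in> networks n"
    show "sqrt (cond_likelihood k n P x z * cond_likelihood k' n P' x z') =
       (\<Prod>p\<in>node_pairs n. sqrt (bern_weight (?p p) (edge x p) * bern_weight (?q p) (edge x p)))"
      unfolding cond_likelihood_eq_prod[OF x P(2,1)] cond_likelihood_eq_prod[OF x P'(2,1)]
      by (simp only: prod.distrib[symmetric] sqrt_prod finite_node_pairs)
  qed
  also have "\<dots> = (\<Prod>p\<in>node_pairs n. sqrt ((1 - ?p p) * (1 - ?q p)) + sqrt (?p p * ?q p))"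
    by (subst sum_networks_prod) (simp add: bern_weight_def)
  also have "\<dots> \<le> (\<Prod>p\<in>node_pairs n. exp (- (1/2) * (sqrt (?p p) - sqrt (?q p))\<^sup>2))"
  proof (intro prod_mono conjI)
    fix p assume "p \<in> node_pairs n"
    then have ij: "fst p \<in> {1..n}" "snd p \<in> {1..n}" by (auto simp: node_pairs_def)
    note b = prob_matrices_label(1,2)[OF P ij] prob_matrices_label(1,2)[OF P' ij]
    show "0 \<le> sqrt ((1 - ?p p) * (1 - ?q p)) + sqrt (?p p * ?q p)"
      using b by (intro add_nonneg_nonneg real_sqrt_ge_zero mult_nonneg_nonneg) auto
    show "sqrt ((1 - ?p p) * (1 - ?q p)) + sqrt (?p p * ?q p) \<le> exp (- (1/2) * (sqrt (?p p) - sqrt (?q p))\<^sup>2)"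
      using b by (intro bhattacharyya_le)
  qed
  also have "\<dots> = exp (\<Sum>p\<in>node_pairs n. - (1/2) * (sqrt (?p p) - sqrt (?q p))\<^sup>2)"
    by (subst exp_sum) auto
  also have "(\<Sum>p\<in>node_pairs n. - (1/2) * (sqrt (?p p) - sqrt (?q p))\<^sup>2) =
      - (1/2) * (\<Sum>p\<in>node_pairs n. (sqrt (?p p) - sqrt (?q p))\<^sup>2)"
    by (rule sum_distrib_left[symmetric])
  finally show ?thesis by (simp add: case_prod_unfold)
qed

text \<open>Pigeonhole: every true community \<open>a\<close> has a large part carrying one fitted label \<open>f a\<close>, and
  since \<open>k < k\<^sub>0\<close> two true communities with different columns share this label.\<close>

lemma separation:
  fixes z z' :: "nat \<Rightarrow> nat"
  assumes P: "P \<in> prob_matrices k\<^sub>0" "z \<in> {1..n} \<rightarrow>\<^sub>E {1..k\<^sub>0}"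
    and P': "P' \<in> prob_matrices k" "z' \<in> {1..n} \<rightarrow>\<^sub>E {1..k}"
    and k: "1 \<le> k" "k < k\<^sub>0"
    and r: "r \<ge> 1" "\<And>a. a \<in> {1..k\<^sub>0} \<Longrightarrow> real k * r \<le> real (node_count n z a)"
    and gap: "\<And>a b. a \<in> {1..k\<^sub>0} \<Longrightarrow> b \<in> {1..k\<^sub>0} \<Longrightarrow> a \<noteq> b \<Longrightarrow>
       \<exists>d\<in>{1..k\<^sub>0}. \<gamma> \<le> (sqrt (P d a) - sqrt (P d b))\<^sup>2" "\<gamma> \<ge> 0"
  shows "r * (r - 1) * \<gamma> / 8 \<le> (\<Sum>(i, j)\<in>node_pairs n. (sqrt (P (z i) (z j)) - sqrt (P' (z' i) (z' j)))\<^sup>2)"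
proof -
  define V where "V = (\<lambda>a c. {i\<in>{1..n}. z i = a \<and> z' i = c})"
  have "\<exists>c\<in>{1..k}. r \<le> real (card (V a c))" if a: "a \<in> {1..k\<^sub>0}" for a
  proof (rule ccontr)
    assume "\<not> (\<exists>c\<in>{1..k}. r \<le> real (card (V a c)))"
    then have "(\<Sum>c\<in>{1..k}. real (card (V a c))) < (\<Sum>c\<in>{1..k}. r)"
      using k by (intro sum_strict_mono) (auto simp: not_le)
    moreover have "(\<Sum>c\<in>{1..k}. card (V a c)) = node_count n z a"
    proof -
      have "(\<Sum>c\<in>{1..k}. card (V a c)) = (\<Sum>c\<in>{1..k}. \<Sum>i\<in>{i\<in>{i\<in>{1..n}. z i = a}. z' i = c}. 1)"
        by (simp add: V_def conj_ac)
      also have "\<dots> = (\<Sum>i\<in>{i\<in>{1..n}. z i = a}. 1)"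
        using P' by (intro sum.group) auto
      finally show ?thesis by (simp add: node_count_eq_card)
    qed
    ultimately show False using r(2)[OF a] by (simp flip: of_nat_sum)
  qed
  then obtain f where f: "\<And>a. a \<in> {1..k\<^sub>0} \<Longrightarrow> f a \<in> {1..k}" "\<And>a. a \<in> {1..k\<^sub>0} \<Longrightarrow> r \<le> real (card (V a (f a)))"
    by metis
  have "card (f ` {1..k\<^sub>0}) \<le> card {1..k}"
    using f(1) by (intro card_mono) auto
  then have "\<not> inj_on f {1..k\<^sub>0}"
    using k by (intro pigeonhole) simp
  then obtain a b where ab: "a \<in> {1..k\<^sub>0}" "b \<in> {1..k\<^sub>0}" "a \<noteq> b" "f a = f b"
    by (auto simp: inj_on_def)
  obtain d where d: "d \<in> {1..k\<^sub>0}" "\<gamma> \<le> (sqrt (P d a) - sqrt (P d b))\<^sup>2"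
    using gap(1)[OF ab(1-3)] by blast
  define q where "q = sqrt (P' (f d) (f a))"
  \<comment> \<open>As \<open>f a = f b\<close>, the smaller model fits one value \<open>q\<close>
    both to the block of \<open>d\<close> and \<open>a\<close> and to that of \<open>d\<close> and
    \<open>b\<close>. It cannot be close to two values that differ; \<open>c\<close> below is the
    community where it misses by at least \<open>\<gamma> / 4\<close>.\<close>
  have "\<gamma> \<le> 2 * (sqrt (P d a) - q)\<^sup>2 + 2 * (sqrt (P d b) - q)\<^sup>2"
  proof -
    have "(sqrt (P d a) - sqrt (P d b))\<^sup>2 \<le> 2 * (sqrt (P d a) - q)\<^sup>2 + 2 * (sqrt (P d b) - q)\<^sup>2"
      using zero_le_power2[of "sqrt (P d a) + sqrt (P d b) - 2 * q"] by (simp add: power2_eq_square algebra_simps)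
    then show ?thesis using d(2) by linarith
  qed
  then obtain c where c: "c \<in> {1..k\<^sub>0}" "f c = f a" "\<gamma> / 4 \<le> (sqrt (P d c) - q)\<^sup>2"
  proof (cases "\<gamma> / 4 \<le> (sqrt (P d a) - q)\<^sup>2")
    case False
    then have "\<gamma> / 4 \<le> (sqrt (P d b) - q)\<^sup>2"
      using \<open>\<gamma> \<le> 2 * (sqrt (P d a) - q)\<^sup>2 + 2 * (sqrt (P d b) - q)\<^sup>2\<close> by simp
    then show ?thesis using ab that by auto
  qed (use ab that in auto)
  define U W where "U = V d (f d)" and "W = V c (f c)"
  have UW: "U \<subseteq> {1..n}" "W \<subseteq> {1..n}" "finite U" "finite W"
    by (auto simp: U_def W_def V_def)
  have cUW: "r \<le> real (card U)" "r \<le> real (card W)"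
    using f(2)[OF d(1)] f(2)[OF c(1)] by (auto simp: U_def W_def)
  define D where "D = (\<lambda>i j. (sqrt (P (z i) (z j)) - sqrt (P' (z' i) (z' j)))\<^sup>2)"
  \<comment> \<open>\<open>d\<close> and \<open>c\<close> may coincide, and then
    \<open>U = W\<close>, so the diagonal has to be excluded: each row loses at most one entry,
    which gives \<open>r - 1\<close>. Every unordered pair is counted at most twice, which turns
    \<open>\<gamma> / 4\<close> into \<open>\<gamma> / 8\<close>.\<close>
  define D' where "D' = (\<lambda>i j. if i = j then 0 else D i j)"
  have D: "\<gamma> / 4 \<le> D i j" if "i \<in> U" "j \<in> W" for i j
    using that c(2,3) by (auto simp: D_def U_def W_def V_def q_def)
  have sym: "D i j = D j i" if "i \<in> {1..n}" "j \<in> {1..n}" for i j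
    unfolding D_def using prob_matrices_label(3)[OF P that] prob_matrices_label(3)[OF P' that] by simp
  have "r * (r - 1) * (\<gamma> / 4) \<le> real (card U) * (real (card W) - 1) * (\<gamma> / 4)"
    using r cUW gap(2) by (intro mult_right_mono mult_mono) auto
  also have "\<dots> = (\<Sum>i\<in>U. (real (card W) - 1) * (\<gamma> / 4))" by simp
  also have "\<dots> \<le> (\<Sum>i\<in>U. \<Sum>j\<in>W - {i}. \<gamma> / 4)"
  proof (rule sum_mono)
    fix i
    have "real (card W) - 1 \<le> real (card (W - {i}))"
      proof -
      have "card W \<le> card (W - {i}) + 1"
        using UW by (cases "i \<in> W") (auto simp: card_Diff_singleton)
      then show ?thesis by linarith
    qed
    then have "(real (card W) - 1) * (\<gamma> / 4) \<le> real (card (W - {i})) * (\<gamma> / 4)"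
      using gap(2) by (intro mult_right_mono) auto
    then show "(real (card W) - 1) * (\<gamma> / 4) \<le> (\<Sum>j\<in>W - {i}. \<gamma> / 4)" by simp
  qed
  also have "\<dots> \<le> (\<Sum>i\<in>U. \<Sum>j\<in>W - {i}. D' i j)"
    using D by (intro sum_mono) (auto simp: D'_def)
  also have "\<dots> \<le> (\<Sum>i\<in>U. \<Sum>j=1..n. D' i j)"
    using UW by (intro sum_mono sum_mono2) (auto simp: D'_def D_def)
  also have "\<dots> \<le> (\<Sum>i=1..n. \<Sum>j=1..n. D' i j)"
    using UW by (intro sum_mono2 sum_nonneg) (auto simp: D'_def D_def)
  also have "\<dots> = (\<Sum>(i, j)\<in>node_pairs n. D' i j + D' j i)"
    unfolding sum_square_node_pairs by (simp add: D'_def)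
  also have "\<dots> = (\<Sum>(i, j)\<in>node_pairs n. 2 * D i j)"
    using sym by (intro sum.cong refl) (auto simp: D'_def node_pairs_def)
  also have "\<dots> = 2 * (\<Sum>(i, j)\<in>node_pairs n. D i j)"
    by (simp add: sum_distrib_left case_prod_unfold)
  finally show ?thesis by (simp add: D_def)
qed

section \<open>Finitely many candidates for the smaller model\<close>

definition grid_matrix :: "nat \<Rightarrow> (nat \<Rightarrow> nat) \<Rightarrow> (nat \<times> nat \<Rightarrow> nat) \<Rightarrow> nat \<Rightarrow> nat \<Rightarrow> real" where
  "grid_matrix n z t a b = min 1 (real (t (min a b, max a b)) / real (pair_count n z (min a b) (max a b)))"

text \<open>True for every \<open>t\<close>, even for counts exceeding the number of pairs: the
  minimum with 1 caps the ratio, and an empty block gives \<open>0\<close> by division by zero. Thus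
  all of \<open>PiE\<close> can serve as the index set.\<close>

lemma grid_matrix_prob_matrices: "grid_matrix n z t \<in> prob_matrices k"
  by (auto simp: prob_matrices_def grid_matrix_def min.commute max.commute)

text \<open>For fixed labels the maximizing \<open>P\<close> consists of the observed edge frequencies, so only
  polynomially many candidates arise.\<close>

lemma cond_likelihood_le_grid:
  assumes x: "x \<in> networks n" and P: "P \<in> prob_matrices k"
  shows "cond_likelihood k n P x z \<le>
    (\<Sum>t\<in>class_pairs k \<rightarrow>\<^sub>E {0..n * n}. cond_likelihood k n (grid_matrix n z t) x z)"
proof -
  define t where "t = restrict (\<lambda>(a, b). edge_count n x z a b) (class_pairs k)"
  have t: "t \<in> class_pairs k \<rightarrow>\<^sub>E {0..n * n}"
    using order_trans[OF edge_count_le_pair_count[OF x] pair_count_le]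
    by (auto simp: t_def class_pairs_def)
  have "cond_likelihood k n P x z \<le> cond_likelihood k n (grid_matrix n z t) x z"
    unfolding cond_likelihood_altdef
  proof (intro prod_mono, clarify, intro conjI)
    fix a b assume ab: "(a, b) \<in> class_pairs k"
    then have le: "a \<le> b" by (simp add: class_pairs_def)
    have p: "0 \<le> P a b" "P a b \<le> 1" using P ab by (auto simp: prob_matrices_def class_pairs_def)
    then show "0 \<le> P a b ^ edge_count n x z a b * (1 - P a b) ^ (pair_count n z a b - edge_count n x z a b)"
      by simp
    define m l N where "m = edge_count n x z a b" and "l = pair_count n z a b - edge_count n x z a b"
      and "N = real (pair_count n z a b)"
    have N: "N = real m + real l"
      using edge_count_le_pair_count[OF x le, of z] by (simp add: m_def l_def N_def)
    have g: "grid_matrix n z t a b = real m / N"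
      proof -
      have "grid_matrix n z t a b = min 1 (real m / N)"
        using ab le by (simp add: grid_matrix_def t_def m_def N_def)
      moreover have "real m / N \<le> 1" using N by (simp add: divide_le_eq_1) linarith
      ultimately show ?thesis by simp
    qed
    \<comment> \<open>For an empty block the two bases differ, but then the exponent
      \<open>l\<close> is 0.\<close>
    have lN: "(real l / N) ^ l \<le> (1 - real m / N) ^ l"
    proof (cases "N = 0")
      case True
      then have "l = 0" using N by simp
      then show ?thesis by simp
    next
      case False
      then have "real l / N = 1 - real m / N" using N by (simp add: field_simps)
      then show ?thesis by simp
    qed
    \<comment> \<open>Gibbs' inequality for two outcomes: as \<open>N = m + l\<close>, the
      exponential factors cancel.\<close>
    have "P a b ^ m * (1 - P a b) ^ l \<le>
        ((real m / N) ^ m * exp (P a b * N - real m)) * ((real l / N) ^ l * exp ((1 - P a b) * N - real l))"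
      using p N by (intro mult_mono weight_power_le mult_nonneg_nonneg) auto
    also have "\<dots> = (real m / N) ^ m * (real l / N) ^ l * (exp (P a b * N - real m) * exp ((1 - P a b) * N - real l))"
      by simp
    also have "exp (P a b * N - real m) * exp ((1 - P a b) * N - real l) = 1"
      by (subst exp_add[symmetric]) (simp add: N algebra_simps)
    also have "(real m / N) ^ m * (real l / N) ^ l * 1 \<le> (real m / N) ^ m * (1 - real m / N) ^ l"
      using lN N by (simp add: mult_left_mono)
    finally show "P a b ^ edge_count n x z a b * (1 - P a b) ^ (pair_count n z a b - edge_count n x z a b)
      \<le> grid_matrix n z t a b ^ edge_count n x z a b *
         (1 - grid_matrix n z t a b) ^ (pair_count n z a b - edge_count n x z a b)"
      unfolding g by (simp add: m_def l_def)
  qed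
  also have "\<dots> \<le> (\<Sum>t\<in>class_pairs k \<rightarrow>\<^sub>E {0..n * n}. cond_likelihood k n (grid_matrix n z t) x z)"
    using t by (intro member_le_sum cond_likelihood_nonneg grid_matrix_prob_matrices finite_PiE) auto
  finally show ?thesis .
qed

lemma label_likelihood_le_one:
  assumes "\<pi> \<in> label_weights k"
  shows "label_likelihood k n \<pi> z \<le> 1"
  unfolding label_likelihood_def
  using assms by (intro prod_le_1 conjI power_le_one zero_le_power)
    (auto simp: label_weights_def intro: less_imp_le)

text \<open>Label weights are bounded by 1 and disappear. What remains is a sum of conditional
  likelihoods free of parameters, so each term can be summed over networks on its own.\<close>

lemma max_likelihood_le_grid:
  assumes k: "k \<ge> 1" and x: "x \<in> networks n"
  shows "max_likelihood k n x \<le> (\<Sum>z\<in>{1..n} \<rightarrow>\<^sub>E {1..k}. \<Sum>t\<in>class_pairs k \<rightarrow>\<^sub>E {0..n * n}.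
     cond_likelihood k n (grid_matrix n z t) x z)"
proof (rule max_likelihood_least[OF k])
  fix \<pi> P assume "\<pi> \<in> label_weights k" and P: "P \<in> prob_matrices k"
  then have "cond_likelihood k n P x z * label_likelihood k n \<pi> z \<le> cond_likelihood k n P x z" for z
    by (intro mult_left_le label_likelihood_le_one cond_likelihood_nonneg)
  then show "likelihood k n \<pi> P x \<le> (\<Sum>z\<in>{1..n} \<rightarrow>\<^sub>E {1..k}. \<Sum>t\<in>class_pairs k \<rightarrow>\<^sub>E {0..n * n}.
     cond_likelihood k n (grid_matrix n z t) x z)"
    unfolding likelihood_def using cond_likelihood_le_grid[OF x P] by (intro sum_mono) (rule order_trans)
qed

text \<open>Chernoff's bound with exponential parameter 1. The expectation of
  \<open>exp (- node_count)\<close> is at most \<open>exp (- (p / 2)) ^ n\<close> because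
  \<open>exp (- 1) \<le> 1/2\<close>; the threshold \<open>p / 4\<close> gives back half of that
  exponent.\<close>

lemma atypical_labels_le:
  assumes \<pi>: "\<pi> \<in> label_weights k" and p: "0 < p" "\<And>a. a \<in> {1..k} \<Longrightarrow> p \<le> \<pi> a"
  shows "(\<Sum>z | z \<in> {1..n} \<rightarrow>\<^sub>E {1..k} \<and> (\<exists>a\<in>{1..k}. real (node_count n z a) < p / 4 * real n).
      label_likelihood k n \<pi> z) \<le> real k * exp (- (p / 4)) ^ n"
proof -
  define B where "B = (\<lambda>a. {z\<in>{1..n} \<rightarrow>\<^sub>E {1..k}. real (node_count n z a) < p / 4 * real n})"
  have one: "(\<Sum>z\<in>B a. label_likelihood k n \<pi> z) \<le> exp (- (p / 4)) ^ n" if a: "a \<in> {1..k}" for a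
  proof -
    have nc: "exp (- real (node_count n z a)) = (\<Prod>i=1..n. exp (- of_bool (z i = a)))" for z
      by (simp only: node_count_def exp_sum[symmetric] finite_atLeastAtMost of_nat_sum of_nat_of_bool sum_negf)
    have "(\<Sum>z\<in>B a. label_likelihood k n \<pi> z) \<le>
        (\<Sum>z\<in>B a. label_likelihood k n \<pi> z * exp (p / 4 * real n - real (node_count n z a)))"
    proof (rule sum_mono)
      fix z assume "z \<in> B a"
      then have "1 \<le> exp (p / 4 * real n - real (node_count n z a))" by (simp add: B_def)
      then show "label_likelihood k n \<pi> z \<le> label_likelihood k n \<pi> z * exp (p / 4 * real n - real (node_count n z a))"
        using mult_left_mono[OF _ label_likelihood_nonneg[OF \<pi>, of n z], of 1] by simp
    qed
    also have "\<dots> \<le> (\<Sum>z\<in>{1..n} \<rightarrow>\<^sub>E {1..k}. label_likelihood k n \<pi> z * exp (p / 4 * real n - real (node_count n z a)))"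
      by (intro sum_mono2) (auto simp: B_def intro!: mult_nonneg_nonneg label_likelihood_nonneg \<pi>)
    also have "\<dots> = exp (p / 4 * real n) * (\<Sum>z\<in>{1..n} \<rightarrow>\<^sub>E {1..k}. \<Prod>i=1..n. \<pi> (z i) * exp (- of_bool (z i = a)))"
      unfolding sum_distrib_left
      by (intro sum.cong refl)
         (simp only: exp_diff prod.distrib nc[symmetric] label_likelihood_eq_prod, simp add: exp_minus field_simps)
    also have "\<dots> = exp (p / 4 * real n) * (\<Sum>c=1..k. \<pi> c * exp (- of_bool (c = a))) ^ n"
      by (simp only: sum_prod_labels[where f = "\<lambda>c. \<pi> c * exp (- of_bool (c = a))"])
    also have "\<dots> \<le> exp (p / 4 * real n) * exp (- (p / 2)) ^ n"
    proof (intro mult_left_mono power_mono)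
      have pos: "\<pi> c \<ge> 0" if "c \<in> {1..k}" for c using p(2)[OF that] p(1) by linarith
      then show "0 \<le> (\<Sum>c=1..k. \<pi> c * exp (- of_bool (c = a)))"
        by (intro sum_nonneg) auto
      have e: "exp (- 1 :: real) \<le> 1/2"
        using exp_ge_add_one_self[of "1::real"] by (simp add: exp_minus field_simps)
      have "(\<Sum>c=1..k. \<pi> c * exp (- of_bool (c = a))) \<le> (\<Sum>c=1..k. \<pi> c - (if c = a then \<pi> a / 2 else 0))"
        using mult_left_mono[OF e pos[OF a]] by (intro sum_mono) auto
      also have "\<dots> = 1 - \<pi> a / 2"
        using \<pi> a by (simp add: sum_subtractf label_weights_def)
      also have "\<dots> \<le> 1 + - (p / 2)" using p(2)[OF a] by simp
      also have "\<dots> \<le> exp (- (p / 2))" by (rule exp_ge_add_one_self)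
      finally show "(\<Sum>c=1..k. \<pi> c * exp (- of_bool (c = a))) \<le> exp (- (p / 2))" .
    qed auto
    also have "\<dots> = exp (- (p / 4)) ^ n"
      by (simp add: exp_of_nat_mult[symmetric] exp_add[symmetric] field_simps)
    finally show ?thesis .
  qed
  have "{z. z \<in> {1..n} \<rightarrow>\<^sub>E {1..k} \<and> (\<exists>a\<in>{1..k}. real (node_count n z a) < p / 4 * real n)} = (\<Union>a\<in>{1..k}. B a)"
    by (auto simp: B_def)
  then have "(\<Sum>z | z \<in> {1..n} \<rightarrow>\<^sub>E {1..k} \<and> (\<exists>a\<in>{1..k}. real (node_count n z a) < p / 4 * real n).
      label_likelihood k n \<pi> z) \<le> (\<Sum>a\<in>{1..k}. \<Sum>z\<in>B a. label_likelihood k n \<pi> z)"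
    using \<pi> by (simp only:, intro sum_UN_le) (auto simp: B_def intro: label_likelihood_nonneg)
  also have "\<dots> \<le> (\<Sum>a\<in>{1..k}. exp (- (p / 4)) ^ n)"
    by (intro sum_mono one)
  finally show ?thesis by simp
qed

section \<open>Summability of the underestimation probabilities\<close>

lemma eventually_powr_le_exp:
  fixes C s :: real
  shows "\<forall>\<^sub>F n in sequentially. C * real (Suc n) powr s \<le> exp (real n)"
proof -
  define K where "K = nat \<lceil>\<bar>s\<bar>\<rceil>"
  define D where "D = \<bar>C\<bar> + 1"
  have "((\<lambda>x::real. x ^ K / exp x) \<longlongrightarrow> 0) at_top" by (rule tendsto_power_div_exp_0)
  then have "((\<lambda>n. real (Suc n) ^ K / exp (real (Suc n))) \<longlongrightarrow> 0) sequentially"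
    by (rule filterlim_compose) (intro filterlim_compose[OF filterlim_real_sequentially] filterlim_Suc)
  then have "\<forall>\<^sub>F n in sequentially. real (Suc n) ^ K / exp (real (Suc n)) < 1 / (D * exp 1)"
    by (rule order_tendstoD) (simp add: D_def)
  then show ?thesis
  proof eventually_elim
    case (elim n)
    have "C * real (Suc n) powr s \<le> D * real (Suc n) ^ K"
    proof (rule mult_mono)
      have "real (Suc n) powr s \<le> real (Suc n) powr real K"
        by (intro powr_mono) (auto simp: K_def, linarith)
      then show "real (Suc n) powr s \<le> real (Suc n) ^ K"
        by (simp add: powr_realpow)
    qed (auto simp: D_def)
    also have "\<dots> \<le> exp (real n)"
    proof -
      have "real (Suc n) ^ K < 1 / (D * exp 1) * exp (real (Suc n))"
        using elim by (subst (asm) pos_divide_less_eq) auto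
      also have "\<dots> = exp (real n) / D"
        by (simp add: exp_add)
      finally show ?thesis
        by (subst (asm) pos_less_divide_eq) (auto simp: D_def mult.commute)
    qed
    finally show ?case .
  qed
qed

text \<open>Since \<open>c = sqrt c * sqrt c\<close> for \<open>c = cond_likelihood k\<^sub>0 n P x z\<close>, bounding one factor by the
  candidates of the smaller model turns the sum over \<open>x\<close> into Bhattacharyya coefficients.\<close>

lemma underestimation_typical_le:
  assumes P: "P \<in> prob_matrices k\<^sub>0" "z \<in> {1..n} \<rightarrow>\<^sub>E {1..k\<^sub>0}"
    and \<pi>: "\<pi> \<in> label_weights k\<^sub>0"
    and k: "1 \<le> k" "k < k\<^sub>0"
    and r: "r \<ge> 1" "\<And>a. a \<in> {1..k\<^sub>0} \<Longrightarrow> real k * r \<le> real (node_count n z a)"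
    and gap: "\<And>a b. a \<in> {1..k\<^sub>0} \<Longrightarrow> b \<in> {1..k\<^sub>0} \<Longrightarrow> a \<noteq> b \<Longrightarrow>
       \<exists>d\<in>{1..k\<^sub>0}. \<gamma> \<le> (sqrt (P d a) - sqrt (P d b))\<^sup>2" "\<gamma> \<ge> 0"
    and B: "B \<subseteq> networks n" "\<And>x. x \<in> B \<Longrightarrow> max_likelihood k\<^sub>0 n x \<le> R * max_likelihood k n x"
    and R: "R \<ge> 0" and q: "0 < q" "q \<le> label_likelihood k\<^sub>0 n \<pi> z"
  shows "(\<Sum>x\<in>B. cond_likelihood k\<^sub>0 n P x z) \<le>
    sqrt (R / q) * (real k ^ n * real (Suc (n * n)) ^ card (class_pairs k)) * exp (- (r * (r - 1) * \<gamma> / 16))"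
proof -
  define T where "T = ({1..n} \<rightarrow>\<^sub>E {1..k}) \<times> (class_pairs k \<rightarrow>\<^sub>E {0..n * n})"
  define c where "c = (\<lambda>x (z', t). cond_likelihood k n (grid_matrix n z' t) x z')"
  define c0 where "c0 = (\<lambda>x. cond_likelihood k\<^sub>0 n P x z)"
  have T: "finite T" unfolding T_def by (intro finite_cartesian_product finite_PiE) auto
  have c_nonneg: "c x s \<ge> 0" for x s
    by (cases s) (simp add: c_def cond_likelihood_nonneg[OF grid_matrix_prob_matrices])
  have c0_nonneg: "c0 x \<ge> 0" for x by (simp add: c0_def cond_likelihood_nonneg[OF P(1)])
  have one: "c0 x \<le> sqrt (R / q) * (\<Sum>s\<in>T. sqrt (c0 x * c x s))" if x: "x \<in> B" for x
  proof -
    have xn: "x \<in> networks n" using x B by auto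
    \<comment> \<open>The assumption on \<open>B\<close> compares maximum likelihoods only. One
      labeling of probability at least \<open>q\<close> already accounts for
      \<open>c0 x * q\<close>, so the comparison reaches the conditional likelihood at the price
      \<open>1 / q\<close>.\<close>
    have "c0 x * q \<le> c0 x * label_likelihood k\<^sub>0 n \<pi> z"
      using q c0_nonneg by (intro mult_left_mono) auto
    also have "\<dots> \<le> likelihood k\<^sub>0 n \<pi> P x"
      unfolding likelihood_def c0_def using P \<pi>
      by (intro member_le_sum[of z _ "\<lambda>z. cond_likelihood k\<^sub>0 n P x z * label_likelihood k\<^sub>0 n \<pi> z"]
          mult_nonneg_nonneg cond_likelihood_nonneg label_likelihood_nonneg) auto
    also have "\<dots> \<le> max_likelihood k\<^sub>0 n x"
      by (rule likelihood_le_max_likelihood[OF \<pi> P(1) xn])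
    also have "\<dots> \<le> R * max_likelihood k n x" by (rule B(2)[OF x])
    also have "\<dots> \<le> R * (\<Sum>s\<in>T. c x s)"
      using max_likelihood_le_grid[OF k(1) xn] R
      by (intro mult_left_mono) (simp_all add: T_def c_def sum.cartesian_product)
    finally have "c0 x \<le> R / q * (\<Sum>s\<in>T. c x s)" using q by (simp add: field_simps)
    then have "sqrt (c0 x) \<le> sqrt (R / q) * sqrt (\<Sum>s\<in>T. c x s)"
      by (simp only: real_sqrt_mult[symmetric] real_sqrt_le_iff)
    also have "\<dots> \<le> sqrt (R / q) * (\<Sum>s\<in>T. sqrt (c x s))"
      using R q by (intro mult_left_mono sqrt_sum_le T c_nonneg) auto
    finally have "sqrt (c0 x) * sqrt (c0 x) \<le> sqrt (c0 x) * (sqrt (R / q) * (\<Sum>s\<in>T. sqrt (c x s)))"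
      using c0_nonneg by (intro mult_left_mono) auto
    also have "\<dots> = sqrt (R / q) * (\<Sum>s\<in>T. sqrt (c0 x * c x s))"
      by (simp add: sum_distrib_left real_sqrt_mult mult_ac)
    finally show ?thesis using c0_nonneg by simp
  qed
  have "(\<Sum>x\<in>B. c0 x) \<le> (\<Sum>x\<in>B. sqrt (R / q) * (\<Sum>s\<in>T. sqrt (c0 x * c x s)))"
    by (intro sum_mono one)
  also have "\<dots> \<le> (\<Sum>x\<in>networks n. sqrt (R / q) * (\<Sum>s\<in>T. sqrt (c0 x * c x s)))"
    using B(1) R q by (intro sum_mono2) (auto intro!: mult_nonneg_nonneg sum_nonneg c0_nonneg c_nonneg)
  also have "\<dots> = sqrt (R / q) * (\<Sum>s\<in>T. \<Sum>x\<in>networks n. sqrt (c0 x * c x s))"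
    by (simp only: sum_distrib_left[symmetric] sum.swap[of _ "networks n"])
  also have "\<dots> \<le> sqrt (R / q) * (\<Sum>s\<in>T. exp (- (r * (r - 1) * \<gamma> / 16)))"
  proof (intro mult_left_mono sum_mono)
    fix s assume "s \<in> T"
    then obtain z' t where s: "s = (z', t)" "z' \<in> {1..n} \<rightarrow>\<^sub>E {1..k}" by (auto simp: T_def)
    have "r * (r - 1) * \<gamma> / 8 \<le>
        (\<Sum>(i, j)\<in>node_pairs n. (sqrt (P (z i) (z j)) - sqrt (grid_matrix n z' t (z' i) (z' j)))\<^sup>2)"
      by (rule separation[OF P grid_matrix_prob_matrices s(2) k r gap])
    then have "exp (- (1/2) * (\<Sum>(i, j)\<in>node_pairs n. (sqrt (P (z i) (z j)) - sqrt (grid_matrix n z' t (z' i) (z' j)))\<^sup>2))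
        \<le> exp (- (r * (r - 1) * \<gamma> / 16))" by (subst exp_le_cancel_iff) linarith
    moreover have "(\<Sum>x\<in>networks n. sqrt (c0 x * c x s)) \<le>
      exp (- (1/2) * (\<Sum>(i, j)\<in>node_pairs n. (sqrt (P (z i) (z j)) - sqrt (grid_matrix n z' t (z' i) (z' j)))\<^sup>2))"
      unfolding s c0_def c_def prod.case
      by (rule sum_sqrt_cond_likelihood_le[OF P grid_matrix_prob_matrices s(2)])
    ultimately show "(\<Sum>x\<in>networks n. sqrt (c0 x * c x s)) \<le> exp (- (r * (r - 1) * \<gamma> / 16))" by linarith
  qed (use R q in auto)
  also have "\<dots> = sqrt (R / q) * (real (card T) * exp (- (r * (r - 1) * \<gamma> / 16)))"
    by simp
  also have "real (card T) = real k ^ n * real (Suc (n * n)) ^ card (class_pairs k)"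
    by (simp add: T_def card_cartesian_product card_PiE)
  finally show ?thesis by (simp add: c0_def mult_ac)
qed

text \<open>Rare labelings contribute geometrically little. For the others, all losses are
  exponential in \<open>n\<close>, while the Bhattacharyya exponent is of order \<open>n\<close>
  times \<open>n * \<rho> n\<close>.\<close>

lemma underestimation_summable:
  assumes k: "1 \<le> k" "k < k\<^sub>0" and \<pi>: "\<pi> \<in> label_weights k\<^sub>0"
    and P: "\<And>n. n \<ge> 1 \<Longrightarrow> P n \<in> prob_matrices k\<^sub>0"
    and \<rho>: "\<And>n. n \<ge> 1 \<Longrightarrow> \<rho> n > 0" "filterlim (\<lambda>n. real n * \<rho> n) at_top sequentially"
    and gap: "\<gamma> > 0" "\<And>n a b. n \<ge> 1 \<Longrightarrow> a \<in> {1..k\<^sub>0} \<Longrightarrow> b \<in> {1..k\<^sub>0} \<Longrightarrow> a \<noteq> b \<Longrightarrow>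
       \<exists>d\<in>{1..k\<^sub>0}. \<rho> n * \<gamma> \<le> (sqrt (P n d a) - sqrt (P n d b))\<^sup>2"
    and \<epsilon>: "\<epsilon> > 0"
  shows "summable (\<lambda>n. \<Sum>x\<in>{x\<in>networks n. nml_criterion \<epsilon> n x k\<^sub>0 \<le> nml_criterion \<epsilon> n x k}.
           likelihood k\<^sub>0 n \<pi> (P n) x)"
proof -
  have k0: "k\<^sub>0 \<ge> 1" using k by simp
  define B where "B = (\<lambda>n. {x\<in>networks n. nml_criterion \<epsilon> n x k\<^sub>0 \<le> nml_criterion \<epsilon> n x k})"
  define p where "p = Min (\<pi> ` {1..k\<^sub>0})"
  have "p \<in> \<pi> ` {1..k\<^sub>0}" unfolding p_def using k0 by (intro Min_in) auto
  then have p: "0 < p" "p \<le> 1" using \<pi> by (auto simp: label_weights_def)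
  have p_le: "p \<le> \<pi> a" if "a \<in> {1..k\<^sub>0}" for a
    unfolding p_def using that by (intro Min_le) auto
  define e where "e = (real k\<^sub>0 * (real k\<^sub>0 + 2) - 1) / 2"
  obtain C' where C': "C' > 0" "\<And>n. (\<Sum>x\<in>networks n. max_likelihood k\<^sub>0 n x) \<le> C' * real (Suc n) powr e"
    unfolding e_def by (rule sum_max_likelihood_le[OF k0]) blast
  define C where "C = max 1 C'"
  define b where "b = (\<Sum>i=1..k\<^sub>0 - 1. (real i * (real i + 2) + 1 + \<epsilon>) / 2)"
  have b: "b \<ge> 0" unfolding b_def using \<epsilon> by (intro sum_nonneg) auto
  have "1 * 2 \<le> real k\<^sub>0 * (real k\<^sub>0 + 2)" using k0 by (intro mult_mono) auto
  then have e: "e \<ge> 0" by (simp add: e_def)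
  \<comment> \<open>\<open>e\<close> comes from the Shtarkov sum of the true model and
    \<open>b\<close> from its penalty. The maximum with 1 in \<open>C\<close> ensures
    \<open>R n \<ge> 1\<close>, which later allows replacing \<open>sqrt (R n / p ^ n)\<close> by
    \<open>R n / p ^ n\<close>.\<close>
  define R where "R = (\<lambda>n. C * real (Suc n) powr (e + b))"
  have R1: "R n \<ge> 1" for n
  proof -
    have "1 * 1 \<le> C * real (Suc n) powr (e + b)"
      using b e by (intro mult_mono ge_one_powr_ge_zero) (auto simp: C_def)
    then show ?thesis by (simp add: R_def)
  qed
  have BR: "max_likelihood k\<^sub>0 n x \<le> R n * max_likelihood k n x" if x: "x \<in> B n" and n: "n \<ge> 1" for x n
  proof -
    have xn: "x \<in> networks n" using x by (simp add: B_def)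
    define S0 S where "S0 = (\<Sum>x\<in>networks n. max_likelihood k\<^sub>0 n x)"
      and "S = (\<Sum>x\<in>networks n. max_likelihood k n x)"
    have S: "S0 \<ge> 1" "S \<ge> 1" unfolding S0_def S_def using k by (auto intro: sum_max_likelihood_ge)
    have pen: "pen \<epsilon> k\<^sub>0 n = b * ln (real n)" by (simp add: pen_def b_def sum_distrib_right)
    have "pen \<epsilon> k n \<ge> 0" unfolding pen_def using \<epsilon> n by (intro sum_nonneg mult_nonneg_nonneg) auto
    then have "exp (pen \<epsilon> k\<^sub>0 n - pen \<epsilon> k n) \<le> exp (b * ln (real n))" by (simp add: pen)
    also have "\<dots> = real n powr b" using n by (simp add: powr_def)
    also have "\<dots> \<le> real (Suc n) powr b" using b by (intro powr_mono2) auto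
    finally have ep: "exp (pen \<epsilon> k\<^sub>0 n - pen \<epsilon> k n) \<le> real (Suc n) powr b" .
    have mk: "max_likelihood k n x > 0" by (rule max_likelihood_pos[OF k(1) xn])
    have "max_likelihood k\<^sub>0 n x = S0 * NML k\<^sub>0 n x" using S by (simp add: NML_def S0_def[symmetric])
    also have "\<dots> \<le> S0 * (exp (pen \<epsilon> k\<^sub>0 n - pen \<epsilon> k n) * NML k n x)"
      using x S k by (intro mult_left_mono NML_le_of_criterion_le) (auto simp: B_def)
    also have "\<dots> \<le> S0 * (real (Suc n) powr b * max_likelihood k n x)"
    proof -
      \<comment> \<open>The Shtarkov sum of the smaller model is at least 1, so dividing by it can
        only decrease the value.\<close>
      have "NML k n x \<le> max_likelihood k n x"
        unfolding NML_def S_def[symmetric] using S mk by (simp add: divide_le_eq mult_le_cancel_left1)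
      then show ?thesis
        using S ep less_imp_le[OF NML_pos[OF k(1) xn]] by (intro mult_left_mono mult_mono) auto
    qed
    also have "\<dots> \<le> (C * real (Suc n) powr e) * (real (Suc n) powr b * max_likelihood k n x)"
    proof (rule mult_right_mono)
      have "S0 \<le> C' * real (Suc n) powr e" unfolding S0_def by (rule C')
      also have "\<dots> \<le> C * real (Suc n) powr e" by (intro mult_right_mono) (auto simp: C_def)
      finally show "S0 \<le> C * real (Suc n) powr e" .
    qed (use mk in auto)
    also have "\<dots> = R n * max_likelihood k n x" by (simp add: R_def powr_add)
    finally show ?thesis .
  qed
  \<comment> \<open>A typical labeling gives each community at least \<open>p / 4 * n\<close> nodes;
    divided among the \<open>k\<close> fitted labels, the largest share is at least
    \<open>\<delta> * n\<close>, the \<open>r\<close> of the separation bound.\<close>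
  define \<delta> where "\<delta> = p / (4 * real k)"
  have \<delta>: "\<delta> > 0" using p k by (simp add: \<delta>_def)
  define good where "good = (\<lambda>n. {z\<in>{1..n} \<rightarrow>\<^sub>E {1..k\<^sub>0}. \<forall>a\<in>{1..k\<^sub>0}. p / 4 * real n \<le> real (node_count n z a)})"
  define rare where "rare = (\<lambda>n. {z. z \<in> {1..n} \<rightarrow>\<^sub>E {1..k\<^sub>0} \<and> (\<exists>a\<in>{1..k\<^sub>0}. real (node_count n z a) < p / 4 * real n)})"
  define q where "q = card (class_pairs k)"
  define T where "T = (\<lambda>n. R n / p ^ n * (real k ^ n * real (Suc (n * n)) ^ q) *
      exp (- (\<delta> * real n * (\<delta> * real n - 1) * (\<rho> n * \<gamma>) / 16)))"
  have typical: "(\<Sum>x\<in>B n. cond_likelihood k\<^sub>0 n (P n) x z) \<le> T n"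
    if z: "z \<in> good n" and n: "n \<ge> 1" "\<delta> * real n \<ge> 1" for z n
  proof -
    have zl: "z \<in> {1..n} \<rightarrow>\<^sub>E {1..k\<^sub>0}" using z by (simp add: good_def)
    have ql: "p ^ n \<le> label_likelihood k\<^sub>0 n \<pi> z"
    proof -
      have "p ^ n = (\<Prod>i=1..n. p)" by simp
      also have "\<dots> \<le> (\<Prod>i=1..n. \<pi> (z i))"
        using p zl by (intro prod_mono conjI p_le) (auto simp: PiE_iff)
      finally show ?thesis by (simp add: label_likelihood_eq_prod[OF zl])
    qed
    have "(\<Sum>x\<in>B n. cond_likelihood k\<^sub>0 n (P n) x z) \<le>
        sqrt (R n / p ^ n) * (real k ^ n * real (Suc (n * n)) ^ card (class_pairs k)) *
        exp (- (\<delta> * real n * (\<delta> * real n - 1) * (\<rho> n * \<gamma>) / 16))"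
    proof (rule underestimation_typical_le[OF P[OF n(1)] zl \<pi> k n(2) _ gap(2)[OF n(1)] _ _ BR[OF _ n(1)] _ _ ql])
      show "real k * (\<delta> * real n) \<le> real (node_count n z a)" if "a \<in> {1..k\<^sub>0}" for a
        using z that k by (simp add: good_def \<delta>_def)
      show "0 \<le> \<rho> n * \<gamma>" using \<rho>(1)[OF n(1)] gap(1) by simp
      show "0 \<le> R n" using R1[of n] by linarith
    qed (use p in \<open>auto simp: B_def\<close>)
    also have "\<dots> \<le> T n"
    proof -
      have "1 \<le> R n / p ^ n"
        using R1[of n] power_le_one[of p n] p by (simp add: le_divide_eq)
      then have "sqrt (R n / p ^ n) \<le> R n / p ^ n"
        by (intro real_le_lsqrt self_le_power) auto
      then show ?thesis unfolding T_def q_def by (intro mult_right_mono) auto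
    qed
    finally show ?thesis .
  qed
  \<comment> \<open>Once \<open>\<delta> * n \<ge> 2\<close>, the factor
    \<open>\<delta> * n - 1\<close> is at least \<open>\<delta> * n / 2\<close>, so the exponent in
    \<open>T n\<close> is at least \<open>c * n * (n * \<rho> n)\<close>. In \<open>L\<close> the
    logarithms pay for \<open>(k / p) ^ n\<close>, one unit pays for the polynomial factors, and the
    other is left over as \<open>exp (- n)\<close>.\<close>
  define c where "c = \<delta>\<^sup>2 * \<gamma> / 32"
  have c: "c > 0" using \<delta> gap(1) by (simp add: c_def)
  define L where "L = ln (1 / p) + ln (real k) + 2"
  have "\<forall>\<^sub>F n in sequentially. C * real (Suc n) powr (e + b + 2 * real q) \<le> exp (real n)"
    by (rule eventually_powr_le_exp)
  moreover have "\<forall>\<^sub>F n in sequentially. L / c \<le> real n * \<rho> n"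
    using \<rho>(2) by (simp add: filterlim_at_top)
  moreover have "\<forall>\<^sub>F n in sequentially. 2 / \<delta> \<le> real n"
    using filterlim_real_sequentially by (simp add: filterlim_at_top)
  moreover have "\<forall>\<^sub>F n in sequentially. n \<ge> (1::nat)"
    by (rule eventually_ge_at_top)
  ultimately have "\<forall>\<^sub>F n in sequentially. norm (\<Sum>x\<in>B n. likelihood k\<^sub>0 n \<pi> (P n) x) \<le>
      real k\<^sub>0 * exp (- (p / 4)) ^ n + exp (- 1) ^ n"
  proof eventually_elim
    case (elim n)
    have Pn: "P n \<in> prob_matrices k\<^sub>0" by (rule P[OF elim(4)])
    have r2: "\<delta> * real n \<ge> 2" using elim(3) \<delta> by (simp add: field_simps)
    have \<rho>n: "\<rho> n > 0" by (rule \<rho>(1)[OF elim(4)])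
    have Tn: "T n \<le> exp (- 1) ^ n"
    proof -
      have "real (Suc (n * n)) ^ q \<le> (real (Suc n) ^ 2) ^ q"
        by (intro power_mono) (auto simp: power2_eq_square algebra_simps)
      also have "\<dots> = real (Suc n) powr (2 * real q)"
        using powr_realpow[of "real (Suc n)" "2 * q"] by (simp add: power_mult)
      finally have "R n * real (Suc (n * n)) ^ q \<le> R n * real (Suc n) powr (2 * real q)"
        using R1[of n] by (intro mult_left_mono) auto
      also have "\<dots> = C * real (Suc n) powr (e + b + 2 * real q)"
        by (simp add: R_def powr_add)
      also have "\<dots> \<le> exp (real n)" by (rule elim(1))
      finally have poly: "R n * real (Suc (n * n)) ^ q \<le> exp (real n)" .
      have kp: "real k ^ n / p ^ n = exp (real n * (L - 2))"
      proof -
        have "exp (L - 2) = real k / p"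
          unfolding L_def using p k by (simp add: exp_add)
        then show ?thesis by (simp add: exp_of_nat_mult power_divide)
      qed
      have "\<delta> * real n * (\<delta> * real n - 1) * (\<rho> n * \<gamma>) / 16 \<ge> real n * L"
      proof -
        have "real n * L \<le> real n * (c * (real n * \<rho> n))"
          using elim(2) c by (intro mult_left_mono) (auto simp: field_simps)
        also have "\<dots> = \<delta> * real n * (\<delta> * real n / 2) * (\<rho> n * \<gamma>) / 16"
          by (simp add: c_def power2_eq_square)
        also have "\<dots> \<le> \<delta> * real n * (\<delta> * real n - 1) * (\<rho> n * \<gamma>) / 16"
          using r2 \<rho>n gap(1) \<delta> by (intro divide_right_mono mult_right_mono mult_left_mono) auto
        finally show ?thesis .
      qed
      then have ex: "exp (- (\<delta> * real n * (\<delta> * real n - 1) * (\<rho> n * \<gamma>) / 16)) \<le> exp (- (real n * L))"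
        by simp
      have "T n = (R n * real (Suc (n * n)) ^ q) * (real k ^ n / p ^ n) *
          exp (- (\<delta> * real n * (\<delta> * real n - 1) * (\<rho> n * \<gamma>) / 16))"
        by (simp add: T_def)
      also have "\<dots> \<le> exp (real n) * exp (real n * (L - 2)) * exp (- (real n * L))"
        unfolding kp using poly ex by (intro mult_mono) auto
      also have "\<dots> = exp (- 1) ^ n"
        by (simp add: exp_add[symmetric] exp_of_nat_mult[symmetric] algebra_simps)
      finally show ?thesis .
    qed
    have "(\<Sum>x\<in>B n. likelihood k\<^sub>0 n \<pi> (P n) x) =
        (\<Sum>z\<in>{1..n} \<rightarrow>\<^sub>E {1..k\<^sub>0}. label_likelihood k\<^sub>0 n \<pi> z * (\<Sum>x\<in>B n. cond_likelihood k\<^sub>0 n (P n) x z))"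
      unfolding likelihood_def by (subst sum.swap) (simp add: sum_distrib_left mult.commute)
    also have "{1..n} \<rightarrow>\<^sub>E {1..k\<^sub>0} = rare n \<union> good n"
      unfolding good_def rare_def not_le[symmetric] by blast
    also have "(\<Sum>z\<in>rare n \<union> good n. label_likelihood k\<^sub>0 n \<pi> z * (\<Sum>x\<in>B n. cond_likelihood k\<^sub>0 n (P n) x z))
      = (\<Sum>z\<in>rare n. label_likelihood k\<^sub>0 n \<pi> z * (\<Sum>x\<in>B n. cond_likelihood k\<^sub>0 n (P n) x z)) +
        (\<Sum>z\<in>good n. label_likelihood k\<^sub>0 n \<pi> z * (\<Sum>x\<in>B n. cond_likelihood k\<^sub>0 n (P n) x z))"
    proof (rule sum.union_disjoint)
      show "finite (rare n)" "finite (good n)"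
        by (rule finite_subset[OF _ finite_labelings[of 1 n 1 k\<^sub>0]]; auto simp: rare_def good_def)+
      show "rare n \<inter> good n = {}"
        unfolding good_def rare_def not_le[symmetric] by blast
    qed
    \<comment> \<open>On rare labelings the conditional probability of \<open>B n\<close> is bounded
      by 1, on the others by \<open>T n\<close>.\<close>
    also have "\<dots> \<le> (\<Sum>z\<in>rare n. label_likelihood k\<^sub>0 n \<pi> z) + (\<Sum>z\<in>good n. label_likelihood k\<^sub>0 n \<pi> z * T n)"
    proof (intro add_mono sum_mono)
      fix z assume "z \<in> rare n"
      then have "z \<in> {1..n} \<rightarrow>\<^sub>E {1..k\<^sub>0}" by (simp add: rare_def)
      then have "(\<Sum>x\<in>B n. cond_likelihood k\<^sub>0 n (P n) x z) \<le> 1"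
        using sum_mono2[of "networks n" "B n" "\<lambda>x. cond_likelihood k\<^sub>0 n (P n) x z"]
          sum_cond_likelihood[of z n k\<^sub>0 "P n"] Pn cond_likelihood_nonneg[OF Pn]
        by (auto simp: B_def)
      then show "label_likelihood k\<^sub>0 n \<pi> z * (\<Sum>x\<in>B n. cond_likelihood k\<^sub>0 n (P n) x z) \<le> label_likelihood k\<^sub>0 n \<pi> z"
        by (intro mult_left_le label_likelihood_nonneg[OF \<pi>])
    next
      fix z assume "z \<in> good n"
      then show "label_likelihood k\<^sub>0 n \<pi> z * (\<Sum>x\<in>B n. cond_likelihood k\<^sub>0 n (P n) x z) \<le> label_likelihood k\<^sub>0 n \<pi> z * T n"
        using elim(4) r2 by (intro mult_left_mono typical label_likelihood_nonneg[OF \<pi>]) auto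
    qed
    also have "(\<Sum>z\<in>good n. label_likelihood k\<^sub>0 n \<pi> z * T n) \<le> T n"
    proof -
      have "(\<Sum>z\<in>good n. label_likelihood k\<^sub>0 n \<pi> z) \<le> (\<Sum>z\<in>{1..n} \<rightarrow>\<^sub>E {1..k\<^sub>0}. label_likelihood k\<^sub>0 n \<pi> z)"
        by (intro sum_mono2 finite_labelings label_likelihood_nonneg[OF \<pi>]) (auto simp: good_def)
      also have "\<dots> = 1" by (rule sum_label_likelihood[OF \<pi>])
      finally have "(\<Sum>z\<in>good n. label_likelihood k\<^sub>0 n \<pi> z) * T n \<le> 1 * T n"
        using R1[of n] p by (intro mult_right_mono) (auto simp: T_def)
      then show ?thesis by (simp add: sum_distrib_right)
    qed
    also have "(\<Sum>z\<in>rare n. label_likelihood k\<^sub>0 n \<pi> z) \<le> real k\<^sub>0 * exp (- (p / 4)) ^ n"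
      unfolding rare_def by (rule atypical_labels_le[OF \<pi> p(1) p_le])
    also note Tn
    finally have "(\<Sum>x\<in>B n. likelihood k\<^sub>0 n \<pi> (P n) x) \<le> real k\<^sub>0 * exp (- (p / 4)) ^ n + exp (- 1) ^ n"
      by simp
    moreover have "(\<Sum>x\<in>B n. likelihood k\<^sub>0 n \<pi> (P n) x) \<ge> 0"
      by (intro sum_nonneg likelihood_nonneg \<pi> Pn)
    ultimately show ?case by simp
  qed
  moreover have "summable (\<lambda>n. real k\<^sub>0 * exp (- (p / 4)) ^ n + exp (- 1) ^ n)"
    using p by (intro summable_add summable_mult summable_geometric) auto
  ultimately show ?thesis unfolding B_def by (rule summable_comparison_test_ev)
qed

section \<open>Separation of columns and the almost sure conclusion\<close>

lemma column_gap:
  assumes "distinct_columns k S"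
  obtains \<gamma> :: real where "\<gamma> > 0"
    "\<And>a b. a \<in> {1..k} \<Longrightarrow> b \<in> {1..k} \<Longrightarrow> a \<noteq> b \<Longrightarrow> \<exists>d\<in>{1..k}. \<gamma> \<le> (sqrt (S d a) - sqrt (S d b))\<^sup>2"
proof -
  \<comment> \<open>Finitely many positive numbers, so the minimum is positive. The element 1 keeps
    the set nonempty when no two entries of a row differ, in particular for
    \<open>k = 1\<close>.\<close>
  define D where "D = insert 1 ((\<lambda>(d, a, b). (sqrt (S d a) - sqrt (S d b))\<^sup>2) `
     {(d, a, b) \<in> {1..k} \<times> {1..k} \<times> {1..k}. S d a \<noteq> S d b})"
  have D: "finite D" "D \<noteq> {}"
  proof -
    have "finite {(d, a, b) \<in> {1..k} \<times> {1..k} \<times> {1..k}. S d a \<noteq> S d b}"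
      by (rule finite_subset[of _ "{1..k} \<times> {1..k} \<times> {1..k}"]) auto
    then show "finite D" "D \<noteq> {}" unfolding D_def by auto
  qed
  show ?thesis
  proof (rule that[of "Min D"])
    show "Min D > 0" using D by (subst Min_gr_iff) (auto simp: D_def)
    fix a b assume ab: "a \<in> {1..k}" "b \<in> {1..k}" "a \<noteq> b"
    then obtain d where d: "d \<in> {1..k}" "S d a \<noteq> S d b"
      using assms unfolding distinct_columns_def by blast
    then have "(sqrt (S d a) - sqrt (S d b))\<^sup>2 \<in> D" using ab by (force simp: D_def)
    then show "\<exists>d\<in>{1..k}. Min D \<le> (sqrt (S d a) - sqrt (S d b))\<^sup>2"
      using Min_le[OF D(1)] d(1) by blast
  qed
qed

theorem theorem3p1:
  fixes M :: "'w measure"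
    and A :: "nat \<Rightarrow> 'w \<Rightarrow> network"
    and k\<^sub>0 :: nat
    and \<pi>\<^sub>0 :: "nat \<Rightarrow> real"
    and S\<^sub>0 :: "nat \<Rightarrow> nat \<Rightarrow> real"
    and \<rho> :: "nat \<Rightarrow> real"
    and \<epsilon> :: real
    and k_hat :: "nat \<Rightarrow> network \<Rightarrow> nat"
  assumes "prob_space M"
    and "k\<^sub>0 \<ge> 1"
    and "\<pi>\<^sub>0 \<in> label_weights k\<^sub>0"
    and "\<And>n. n \<ge> 1 \<Longrightarrow> \<rho> n > 0"
    and "\<And>n. n \<ge> 1 \<Longrightarrow> (\<lambda>a b. \<rho> n * S\<^sub>0 a b) \<in> prob_matrices k\<^sub>0"
    and "\<And>n. n \<ge> 1 \<Longrightarrow> distinct_columns k\<^sub>0 (\<lambda>a b. \<rho> n * S\<^sub>0 a b)"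
    and "(\<rho> \<longlonglongrightarrow> 0 \<and> filterlim (\<lambda>n. real n * \<rho> n) at_top sequentially) \<or> (\<forall>n\<ge>1. \<rho> n = 1)"
    and "\<And>n. n \<ge> 1 \<Longrightarrow> A n \<in> measurable M (count_space (networks n))"
    and "\<And>n. n \<ge> 1 \<Longrightarrow>
           distr M (count_space UNIV) (A n) =
           measure_pmf (sbm_network k\<^sub>0 \<pi>\<^sub>0 (\<lambda>a b. \<rho> n * S\<^sub>0 a b) n)"
    and "\<epsilon> > 0"
    and "\<And>n x. n \<ge> 1 \<Longrightarrow> x \<in> networks n \<Longrightarrow> is_nml_estimate \<epsilon> n x (k_hat n x)"
  shows "AE \<omega> in M. \<forall>\<^sub>F n in sequentially. k_hat n (A n \<omega>) = k\<^sub>0"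
proof -
  interpret prob_space M by fact
  define P where "P = (\<lambda>n a b. \<rho> n * S\<^sub>0 a b)"
  have P: "P n \<in> prob_matrices k\<^sub>0" if "n \<ge> 1" for n using assms(5)[OF that] by (simp add: P_def)
  have n\<rho>: "filterlim (\<lambda>n. real n * \<rho> n) at_top sequentially"
    using assms(7)
  proof
    assume "\<forall>n\<ge>1. \<rho> n = 1"
    then have "\<forall>\<^sub>F n in sequentially. real n = real n * \<rho> n"
      by (intro eventually_mono[OF eventually_ge_at_top[of 1]]) auto
    then show ?thesis using filterlim_real_sequentially filterlim_cong[OF refl refl] by fast
  qed blast
  have "distinct_columns k\<^sub>0 S\<^sub>0"
    using assms(6)[of 1] unfolding distinct_columns_def by fastforce
  then obtain \<gamma> where \<gamma>: "\<gamma> > 0" "\<And>a b. a \<in> {1..k\<^sub>0} \<Longrightarrow> b \<in> {1..k\<^sub>0} \<Longrightarrow> a \<noteq> b \<Longrightarrow>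
      \<exists>d\<in>{1..k\<^sub>0}. \<gamma> \<le> (sqrt (S\<^sub>0 d a) - sqrt (S\<^sub>0 d b))\<^sup>2"
    by (rule column_gap) blast
  \<comment> \<open>The square root splits off \<open>sqrt (\<rho> n)\<close>, so the squared gap
    scales exactly by \<open>\<rho> n\<close> and \<open>\<gamma>\<close> can be chosen once for all
    \<open>n\<close>.\<close>
  have gap: "\<exists>d\<in>{1..k\<^sub>0}. \<rho> n * \<gamma> \<le> (sqrt (P n d a) - sqrt (P n d b))\<^sup>2"
    if n: "n \<ge> 1" and ab: "a \<in> {1..k\<^sub>0}" "b \<in> {1..k\<^sub>0}" "a \<noteq> b" for n a b
  proof -
    have "\<rho> n > 0" by (rule assms(4)[OF n])
    then have "(sqrt (P n d a) - sqrt (P n d b))\<^sup>2 = \<rho> n * (sqrt (S\<^sub>0 d a) - sqrt (S\<^sub>0 d b))\<^sup>2" for d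
      by (simp add: P_def real_sqrt_mult power_mult_distrib flip: right_diff_distrib)
    then show ?thesis using \<gamma>(2)[OF ab] \<open>\<rho> n > 0\<close> by simp
  qed
  define lik where "lik = (\<lambda>n x. likelihood k\<^sub>0 n \<pi>\<^sub>0 (P n) x)"
  define B1 where "B1 = (\<lambda>n. {x\<in>networks n. \<exists>l\<in>{k\<^sub>0<..n}. nml_criterion \<epsilon> n x k\<^sub>0 \<le> nml_criterion \<epsilon> n x l})"
  define B2 where "B2 = (\<lambda>n k. {x\<in>networks n. nml_criterion \<epsilon> n x k\<^sub>0 \<le> nml_criterion \<epsilon> n x k})"
  \<comment> \<open>Ties with \<open>k\<^sub>0\<close> are included, so off this event
    \<open>k\<^sub>0\<close> is the only maximizer and the selection rule behind
    \<open>k_hat\<close> is immaterial. The orders below \<open>k\<^sub>0\<close> form a finite set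
    independent of \<open>n\<close>, so each can be treated separately.\<close>
  define Bad where "Bad = (\<lambda>n. B1 n \<union> (\<Union>k\<in>{1..<k\<^sub>0}. B2 n k))"
  obtain C where C: "C > 0" "\<And>n. n \<ge> 1 \<Longrightarrow> (\<Sum>x\<in>B1 n. lik n x) \<le> C * real n powr - (1 + \<epsilon> / 2)"
  proof (rule overestimation_prob_le[OF assms(2,10,3)])
    fix C assume "C > 0" and C: "\<And>n P. n \<ge> 1 \<Longrightarrow> P \<in> prob_matrices k\<^sub>0 \<Longrightarrow>
      (\<Sum>x\<in>{x\<in>networks n. \<exists>l\<in>{k\<^sub>0<..n}. nml_criterion \<epsilon> n x k\<^sub>0 \<le> nml_criterion \<epsilon> n x l}.
         likelihood k\<^sub>0 n \<pi>\<^sub>0 P x) \<le> C * real n powr - (1 + \<epsilon> / 2)"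
    show thesis
      by (rule that[OF \<open>C > 0\<close>]) (unfold B1_def lik_def, rule C[OF _ P])
  qed
  \<comment> \<open>The law of \<open>A n\<close> is specified from \<open>n = 1\<close> on; the
    empty set fills the index 0.\<close>
  define E where "E = (\<lambda>n. if n = 0 then {} else A n -` Bad n \<inter> space M)"
  have Bad: "Bad n \<subseteq> networks n" for n by (auto simp: Bad_def B1_def B2_def)
  have E_sets: "E n \<in> sets M" for n
    using Bad[of n] assms(8)[of n] by (auto simp: E_def intro!: measurable_sets[of _ M "count_space (networks n)"])
  have lik_nonneg: "lik n x \<ge> 0" if "n \<ge> 1" for n x
    unfolding lik_def by (rule likelihood_nonneg[OF assms(3) P[OF that]])
  have E_le: "measure M (E n) \<le> C * real n powr - (1 + \<epsilon> / 2) + (\<Sum>k\<in>{1..<k\<^sub>0}. \<Sum>x\<in>B2 n k. lik n x)"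
    if n: "n \<ge> 1" for n
  proof -
    have "A n \<in> measurable M (count_space UNIV)"
      using measurable_compose[OF assms(8)[OF n], of id "count_space UNIV"] by (simp add: id_def)
    then have "measure M (E n) = measure (distr M (count_space UNIV) (A n)) (Bad n)"
      using n by (simp add: measure_distr E_def)
    also have "\<dots> = (\<Sum>x\<in>Bad n. lik n x)"
      unfolding assms(9)[OF n] lik_def P_def
      by (rule prob_sbm_network[OF Bad assms(3) assms(5)[OF n]])
    also have "\<dots> \<le> (\<Sum>x\<in>B1 n. lik n x) + (\<Sum>x\<in>(\<Union>k\<in>{1..<k\<^sub>0}. B2 n k). lik n x)"
    proof -
      have "sum (lik n) (Bad n) + sum (lik n) (B1 n \<inter> (\<Union>k\<in>{1..<k\<^sub>0}. B2 n k)) =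
          sum (lik n) (B1 n) + sum (lik n) (\<Union>k\<in>{1..<k\<^sub>0}. B2 n k)"
        unfolding Bad_def by (intro sum.union_inter) (auto simp: B1_def B2_def)
      moreover have "sum (lik n) (B1 n \<inter> (\<Union>k\<in>{1..<k\<^sub>0}. B2 n k)) \<ge> 0"
        by (intro sum_nonneg lik_nonneg n)
      ultimately show ?thesis by simp
    qed
    also have "\<dots> \<le> C * real n powr - (1 + \<epsilon> / 2) + (\<Sum>k\<in>{1..<k\<^sub>0}. \<Sum>x\<in>B2 n k. lik n x)"
      by (intro add_mono C(2)[OF n] sum_UN_le) (auto simp: B2_def intro: lik_nonneg[OF n])
    finally show ?thesis .
  qed
  have "summable (\<lambda>n. C * real n powr - (1 + \<epsilon> / 2) + (\<Sum>k\<in>{1..<k\<^sub>0}. \<Sum>x\<in>B2 n k. lik n x))"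
  proof (intro summable_add summable_mult summable_sum)
    show "summable (\<lambda>n. real n powr - (1 + \<epsilon> / 2))"
      using assms(10) by (subst summable_real_powr_iff) simp
    fix k assume "k \<in> {1..<k\<^sub>0}"
    then show "summable (\<lambda>n. \<Sum>x\<in>B2 n k. lik n x)"
      unfolding B2_def lik_def
      by (intro underestimation_summable[OF _ _ assms(3) P assms(4) n\<rho> \<gamma>(1) gap assms(10)]) auto
  qed
  then have "summable (\<lambda>n. measure M (E n))"
    by (rule summable_comparison_test_ev[rotated])
       (rule eventually_mono[OF eventually_ge_at_top[of 1]], use E_le in simp)
  then have "AE \<omega> in M. \<forall>\<^sub>F n in sequentially. \<omega> \<in> space M - E n"
    by (intro borel_cantelli_AE1 E_sets) (auto simp: emeasure_eq_measure)
  then show ?thesis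
  proof (rule AE_mp, intro AE_I2 impI)
    fix \<omega> assume \<omega>: "\<omega> \<in> space M" and "\<forall>\<^sub>F n in sequentially. \<omega> \<in> space M - E n"
    \<comment> \<open>\<open>n \<ge> k\<^sub>0\<close> makes the true order one of the candidates,
      so the maximizer must do at least as well as it does.\<close>
    from this(2) eventually_ge_at_top[of k\<^sub>0]
    show "\<forall>\<^sub>F n in sequentially. k_hat n (A n \<omega>) = k\<^sub>0"
    proof eventually_elim
      case (elim n)
      then have n: "n \<ge> 1" using assms(2) by simp
      have x: "A n \<omega> \<in> networks n"
        using measurable_space[OF assms(8)[OF n] \<omega>] by simp
      have notbad: "A n \<omega> \<notin> Bad n" using elim(1) n by (auto simp: E_def)
      define l where "l = k_hat n (A n \<omega>)"
      have l: "1 \<le> l" "l \<le> n" "nml_criterion \<epsilon> n (A n \<omega>) k\<^sub>0 \<le> nml_criterion \<epsilon> n (A n \<omega>) l"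
        using assms(11)[OF n x] elim(2) assms(2)
        unfolding is_nml_estimate_def is_arg_max_def nml_criterion_def l_def by (auto simp: not_less)
      show "k_hat n (A n \<omega>) = k\<^sub>0"
      proof (rule ccontr)
        assume "k_hat n (A n \<omega>) \<noteq> k\<^sub>0"
        then consider "l < k\<^sub>0" | "k\<^sub>0 < l" unfolding l_def by linarith
        then have "A n \<omega> \<in> Bad n"
          using l x by cases (auto simp: Bad_def B1_def B2_def)
        with notbad show False ..
      qed
    qed
  qed
qed

end
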